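(* Let $d\ge 3$ and let $\mathcal{T}$ be the maximal triangle averaging operator on $\mathbb{R}^d$. Let $1\le p,q\le\infty$ and let $r$ be given by $\frac1r=\frac1p+\frac1q$. If $\mathcal{T}$ is bounded from $L^p(\mathbb{R}^d)\times L^q(\mathbb{R}^d)$ into $L^r(\mathbb{R}^d)$, then $p>\frac{d}{d-1}$ and $q>\frac{d}{d-1}$.
   Context: Let $M=\{(u,v)\in\mathbb{R}^d\times\mathbb{R}^d : |u|=|v|=|u-v|=1\}$, a compact submanifold of $\mathbb{R}^{2d}$, and let $\mu$ be the surface measure on $M$, normalized to be a probability measure. The maximal triangle averaging operator is $$\mathcal{T}(f,g)(x)=\sup_{t>0}\left|\int_M f(x-tu)\,g(x-tv)\,d\mu(u,v)\right|.$$ Bounded from $L^p\times L^q$ into $L^r$ means that there is a finite constant $C$ with $\|\mathcal{T}(f,g)\|_{L^r}\le C\|f\|_{L^p}\|g\|_{L^q}$ for all Schwartz functions $f,g$ on $\mathbb{R}^d$. The convention $1/\infty=0$ is used, and $r<1$ is allowed. *)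

theory Defs
  imports "HOL-Analysis.Analysis" "HOL-Probability.Essential_Supremum"
begin

text \<open>Hausdorff measure, without the dimensional constant: coverings by countably many bounded sets
  of diameter at most \<open>\<delta>\<close>, then the limit (= supremum) as \<open>\<delta>\<close> decreases to 0.
  The case distinction only matters for \<open>k = 0\<close>, where an empty covering set must not count.\<close>

definition hausdorff_outer :: "nat \<Rightarrow> 'a::metric_space set \<Rightarrow> ennreal" where
  "hausdorff_outer k A =
     (SUP \<delta>\<in>{0::real<..}.
        INF U\<in>{U :: nat \<Rightarrow> 'a set. (\<forall>i. bounded (U i) \<and> diameter (U i) \<le> \<delta>) \<and> A \<subseteq> (\<Union>i. U i)}.
          (\<Sum>i. if U i = {} then 0 else ennreal (diameter (U i) ^ k)))"

definition hausdorff_measure :: "nat \<Rightarrow> 'a::metric_space measure" where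
  "hausdorff_measure k = measure_of UNIV (sets borel) (hausdorff_outer k)"

definition triangle_manifold :: "((real ^ 'n) \<times> (real ^ 'n)) set" where
  "triangle_manifold = {(u, v). norm u = 1 \<and> norm v = 1 \<and> norm (u - v) = 1}"

text \<open>The manifold is cut out of \<open>\<real>\<^sup>d \<times> \<real>\<^sup>d\<close> by three independent equations, so it has dimension
  \<open>2d - 3\<close>, and its surface measure is the Hausdorff measure of that dimension for the Euclidean
  distance on \<open>\<real>\<^sup>d \<times> \<real>\<^sup>d\<close> (the library metric on the product). The omitted dimensional constant
  cancels in the normalization to total mass 1.\<close>

definition triangle_measure :: "((real ^ 'n) \<times> (real ^ 'n)) measure" where
  "triangle_measure = uniform_measure (hausdorff_measure (2 * CARD('n) - 3)) triangle_manifold"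

definition triangle_maximal ::
  "(real ^ 'n \<Rightarrow> complex) \<Rightarrow> (real ^ 'n \<Rightarrow> complex) \<Rightarrow> real ^ 'n \<Rightarrow> ennreal" where
  "triangle_maximal f g x =
     (SUP t\<in>{0::real<..}.
        ennreal (norm (LINT (u, v)|triangle_measure. f (x - t *\<^sub>R u) * g (x - t *\<^sub>R v))))"

fun iter_partial :: "'n list \<Rightarrow> (real ^ 'n \<Rightarrow> complex) \<Rightarrow> real ^ 'n \<Rightarrow> complex" where
  "iter_partial [] f = f"
| "iter_partial (i # is) f =
     (\<lambda>x. frechet_derivative (iter_partial is f) (at x) (axis i 1))"

definition schwartz :: "(real ^ 'n \<Rightarrow> complex) \<Rightarrow> bool" where
  "schwartz f \<longleftrightarrow>
     (\<forall>is. iter_partial is f differentiable_on UNIV) \<and>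
     (\<forall>is (k::nat). bounded (range (\<lambda>x. norm x ^ k *\<^sub>R iter_partial is f x)))"

definition ennreal_powr :: "ennreal \<Rightarrow> real \<Rightarrow> ennreal" where
  "ennreal_powr x a = (if x = \<infinity> then \<infinity> else ennreal (enn2real x powr a))"

text \<open>The \<open>L\<^sup>p\<close> (quasi-)norm for \<open>0 < p \<le> \<infinity>\<close> of a function with values in \<open>[0, \<infinity>]\<close>.\<close>

definition Lp_norm :: "ennreal \<Rightarrow> (real ^ 'n \<Rightarrow> ennreal) \<Rightarrow> ennreal" where
  "Lp_norm p F =
     (if p = \<infinity> then esssup lborel F
      else ennreal_powr (\<integral>\<^sup>+ x. ennreal_powr (F x) (enn2real p) \<partial>lborel) (1 / enn2real p))"

definition triangle_maximal_bounded ::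
  "'n::finite itself \<Rightarrow> ennreal \<Rightarrow> ennreal \<Rightarrow> ennreal \<Rightarrow> bool" where
  "triangle_maximal_bounded _ p q r \<longleftrightarrow>
     (\<exists>C::real. \<forall>f g :: real ^ 'n \<Rightarrow> complex. schwartz f \<longrightarrow> schwartz g \<longrightarrow>
        Lp_norm r (triangle_maximal f g) \<le>
          ennreal C * Lp_norm p (\<lambda>x. ennreal (norm (f x))) * Lp_norm q (\<lambda>x. ennreal (norm (g x))))"

end

theory Submission
  imports Defs "HOL-Probability.Distributions"
begin

text \<open>
  Stein's example: \<open>f\<^sub>N = \<Sum>\<^sub>j\<^sub><\<^sub>N 2\<^bsup>j(d-1)\<^esup> exp(-4\<^sup>j|x|\<^sup>2)\<close> behaves like \<open>|x|\<^bsup>1-d\<^esup>\<close> truncated at scale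
  \<open>2\<^bsup>-N\<^esup>\<close>, so \<open>\<parallel>f\<^sub>N\<parallel>\<^sub>p = o(N)\<close> when \<open>p \<le> d/(d-1)\<close>. Against a fixed Gaussian \<open>g\<close>, the average at \<open>x\<close> with
  \<open>t = |x|\<close> picks up the singularity: if \<open>\<mu>{|u - e| \<le> s} \<ge> c s\<^bsup>d-1\<^esup>\<close> for all unit vectors \<open>e\<close>, each of the \<open>N\<close>
  dyadic pieces contributes a constant, so the maximal function of \<open>(f\<^sub>N, g)\<close> is at least \<open>c N\<close> for
  \<open>1 \<le> |x| \<le> 2\<close>. The cap bound follows from rotation invariance by covering the sphere, once the
  \<open>(2d-3)\<close>-dimensional Hausdorff measure is known to be a Borel measure that is finite and nonzero on the
  manifold. Both follow from volume counting in \<open>\<real>\<^sup>2\<^sup>d\<close>, since every pair of vectors is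
  \<open>(\<alpha> u, \<beta> u + \<gamma> v)\<close> with \<open>(u, v)\<close> in the manifold and three scalars.
\<close>


subsection \<open>Hausdorff outer measure is a metric outer measure\<close>

text \<open>Boundedness is assumed for Schwartz functions only, hence finite sums of Gaussians
  instead of a truncated power: they lie in a class closed under partial derivatives. The exponent
  d-1 is dictated by the cap bound, because the factor 2^(j(d-1)) cancels the mass of a cap of
  radius about 2^-j. It makes p = d/(d-1) critical: there every dyadic piece has L^p norm of order
  1, so the triangle inequality would give O(N), the same order as the lower bound. The gain to
  N^(1/p) comes from the small overlap of pieces of different scales. The exponent r enters only
  through the finite positive volume of a set inside 1 \<le> |x| \<le> 2, so r < 1 causes no
  difficulty. The surface measure is a normalized Hausdorff measure. Were the total mass 0 or
  infinite, the normalization would yield the zero measure and all averages would vanish; this is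
  why both mass bounds are proved. No density is ever computed.\<close>

definition diam_weight :: "nat \<Rightarrow> 'a::metric_space set \<Rightarrow> ennreal" where
  "diam_weight k U = (if U = {} then 0 else ennreal (diameter U ^ k))"

definition fine_covers :: "real \<Rightarrow> 'a::metric_space set \<Rightarrow> (nat \<Rightarrow> 'a set) set" where
  "fine_covers \<delta> A = {U. (\<forall>i. bounded (U i) \<and> diameter (U i) \<le> \<delta>) \<and> A \<subseteq> (\<Union>i. U i)}"

definition hausdorff_content :: "nat \<Rightarrow> real \<Rightarrow> 'a::metric_space set \<Rightarrow> ennreal" where
  "hausdorff_content k \<delta> A = (INF U\<in>fine_covers \<delta> A. \<Sum>i. diam_weight k (U i))"

lemma hausdorff_outer_eq_SUP_content:
  "hausdorff_outer k A = (SUP \<delta>\<in>{0<..}. hausdorff_content k \<delta> A)"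
  unfolding hausdorff_outer_def hausdorff_content_def fine_covers_def diam_weight_def ..

lemma diam_weight_empty [simp]: "diam_weight k {} = 0"
  by (simp add: diam_weight_def)

lemma hausdorff_content_mono: "A \<subseteq> B \<Longrightarrow> hausdorff_content k \<delta> A \<le> hausdorff_content k \<delta> B"
  unfolding hausdorff_content_def fine_covers_def by (rule INF_superset_mono) auto

lemma hausdorff_content_antimono: "\<delta> \<le> \<epsilon> \<Longrightarrow> hausdorff_content k \<epsilon> A \<le> hausdorff_content k \<delta> A"
  unfolding hausdorff_content_def fine_covers_def by (rule INF_superset_mono) (auto intro: order_trans)

lemma hausdorff_content_le_outer: "0 < \<delta> \<Longrightarrow> hausdorff_content k \<delta> A \<le> hausdorff_outer k A"
  unfolding hausdorff_outer_eq_SUP_content by (rule SUP_upper) simp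

lemma hausdorff_outer_least:
  "(\<And>\<delta>. 0 < \<delta> \<Longrightarrow> hausdorff_content k \<delta> A \<le> x) \<Longrightarrow> hausdorff_outer k A \<le> x"
  unfolding hausdorff_outer_eq_SUP_content by (rule SUP_least) simp

lemma hausdorff_content_le:
  assumes "\<And>i. bounded (U i)" "\<And>i. diameter (U i) \<le> \<delta>" "A \<subseteq> (\<Union>i. U i)"
  shows "hausdorff_content k \<delta> A \<le> (\<Sum>i. diam_weight k (U i))"
  unfolding hausdorff_content_def using assms by (intro INF_lower) (auto simp: fine_covers_def)

lemma hausdorff_outer_mono: "A \<subseteq> B \<Longrightarrow> hausdorff_outer k A \<le> hausdorff_outer k B"
  by (intro hausdorff_outer_least order_trans[OF hausdorff_content_mono hausdorff_content_le_outer])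

lemma hausdorff_outer_empty [simp]: "hausdorff_outer k {} = 0"
proof -
  have "hausdorff_content k \<delta> {} \<le> 0" if "0 < \<delta>" for \<delta>
    using hausdorff_content_le[of "\<lambda>_. {}" \<delta> "{}" k] that by simp
  then show ?thesis
    using hausdorff_outer_least[of k "{}" 0] le_zero_eq by blast
qed

text \<open>Near-optimal covers of the \<open>A n\<close>, with errors
  \<open>e * (1/2)^Suc n\<close> of total \<open>e\<close>, are merged into one sequence by
  \<open>prod_decode\<close>. Finiteness of the sum makes each content finite, so that adding an
  error gives a strict inequality and hence a cover below it.\<close>

lemma hausdorff_content_UN:
  "hausdorff_content k \<delta> (\<Union>n. A n) \<le> (\<Sum>n. hausdorff_content k \<delta> (A n))"
proof (rule ennreal_le_epsilon)
  fix e :: real assume e: "0 < e" and fin: "(\<Sum>n. hausdorff_content k \<delta> (A n)) < top"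
  then have *: "hausdorff_content k \<delta> (A n) < hausdorff_content k \<delta> (A n) + e * (1/2)^Suc n" for n
    by (auto simp add: less_top dest!: ennreal_suminf_lessD)
  have "\<exists>U. U \<in> fine_covers \<delta> (A n) \<and>
      (\<Sum>i. diam_weight k (U i)) \<le> hausdorff_content k \<delta> (A n) + e * (1/2)^Suc n" for n
    using *[of n] unfolding hausdorff_content_def INF_less_iff by (meson less_imp_le)
  then obtain U where U: "\<And>n. U n \<in> fine_covers \<delta> (A n)"
    and Ule: "\<And>n. (\<Sum>i. diam_weight k (U n i)) \<le> hausdorff_content k \<delta> (A n) + e * (1/2)^Suc n"
    by metis
  define C where "C = case_prod U \<circ> prod_decode"
  have "(\<Union>n. A n) \<subseteq> (\<Union>i. C i)"
  proof
    fix x assume "x \<in> (\<Union>n. A n)"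
    then obtain n i where "x \<in> U n i"
      using U unfolding fine_covers_def by blast
    then show "x \<in> (\<Union>i. C i)"
      by (auto simp: C_def intro!: exI[of _ "prod_encode (n, i)"])
  qed
  moreover have "bounded (C i)" "diameter (C i) \<le> \<delta>" for i
    using U by (auto simp: C_def fine_covers_def split: prod.split)
  ultimately have "hausdorff_content k \<delta> (\<Union>n. A n) \<le> (\<Sum>i. diam_weight k (C i))"
    by (intro hausdorff_content_le)
  also have "\<dots> = (\<Sum>n. \<Sum>i. diam_weight k (U n i))"
    unfolding C_def comp_def by (intro suminf_ennreal_2dimen) auto
  also have "\<dots> \<le> (\<Sum>n. hausdorff_content k \<delta> (A n) + e * (1/2) ^ Suc n)"
    by (intro suminf_le Ule) auto
  also have "\<dots> = (\<Sum>n. hausdorff_content k \<delta> (A n)) + (\<Sum>n. ennreal e * ennreal ((1/2) ^ Suc n))"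
    using e by (subst suminf_add[symmetric])
      (auto simp del: ennreal_suminf_cmult simp add: ennreal_mult[symmetric])
  also have "\<dots> = (\<Sum>n. hausdorff_content k \<delta> (A n)) + e"
    unfolding ennreal_suminf_cmult
    by (subst suminf_ennreal_eq[OF zero_le_power power_half_series]) auto
  finally show "hausdorff_content k \<delta> (\<Union>n. A n) \<le> (\<Sum>n. hausdorff_content k \<delta> (A n)) + e" .
qed

lemma hausdorff_outer_UN: "hausdorff_outer k (\<Union>n. A n) \<le> (\<Sum>n. hausdorff_outer k (A n))"
  by (intro hausdorff_outer_least order_trans[OF hausdorff_content_UN] suminf_le
      hausdorff_content_le_outer) auto

lemma outer_measure_space_hausdorff: "outer_measure_space UNIV (hausdorff_outer k)"
  unfolding outer_measure_space_def positive_def increasing_def countably_subadditive_def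
  by (auto intro: hausdorff_outer_mono hausdorff_outer_UN)

lemma hausdorff_outer_Un: "hausdorff_outer k (A \<union> B) \<le> hausdorff_outer k A + hausdorff_outer k B"
proof -
  interpret sigma_algebra UNIV "UNIV :: 'a set set"
    using sigma_algebra_Pow[of UNIV] by simp
  have "subadditive UNIV (hausdorff_outer k :: 'a set \<Rightarrow> _)"
    using countably_subadditive_subadditive outer_measure_space_hausdorff[of k]
    by (auto simp: outer_measure_space_def)
  \<comment> \<open>\<open>subadditive\<close> speaks of disjoint sets, hence \<open>B - A\<close>
    in place of \<open>B\<close>.\<close>
  then have "hausdorff_outer k (A \<union> (B - A)) \<le> hausdorff_outer k A + hausdorff_outer k (B - A)"
    unfolding subadditive_def by blast
  also have "\<dots> \<le> hausdorff_outer k A + hausdorff_outer k B"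
    by (intro add_left_mono hausdorff_outer_mono) auto
  finally show ?thesis by simp
qed

text \<open>A set of diameter below the distance of \<open>A\<close> and \<open>B\<close> meets only one of them, so a fine cover of
  the union splits into a cover of \<open>A\<close> and a cover of \<open>B\<close>.\<close>

lemma hausdorff_content_separated:
  assumes "\<delta> < \<eta>" and sep: "\<And>x y. x \<in> A \<Longrightarrow> y \<in> B \<Longrightarrow> \<eta> \<le> dist x y"
  shows "hausdorff_content k \<delta> A + hausdorff_content k \<delta> B \<le> hausdorff_content k \<delta> (A \<union> B)"
  unfolding hausdorff_content_def[of k \<delta> "A \<union> B"]
proof (rule INF_greatest)
  fix U assume U: "U \<in> fine_covers \<delta> (A \<union> B)"
  define V where "V = (\<lambda>i. if U i \<inter> A = {} then {} else U i)"
  define W where "W = (\<lambda>i. if U i \<inter> A = {} then U i else {})"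
  have disj: "U i \<inter> A = {} \<or> U i \<inter> B = {}" for i
  proof (rule ccontr)
    assume "\<not> ?thesis"
    then obtain x y where "x \<in> U i" "x \<in> A" "y \<in> U i" "y \<in> B" by blast
    then have "\<eta> \<le> dist x y" "dist x y \<le> diameter (U i)" "diameter (U i) \<le> \<delta>"
      using sep U diameter_bounded_bound[of "U i" x y] by (auto simp: fine_covers_def)
    then show False using assms(1) by linarith
  qed
  have bU: "bounded (U i)" "diameter (U i) \<le> \<delta>" for i
    using U by (auto simp: fine_covers_def)
  have diameter_nonneg: "0 \<le> \<delta>"
    using bU[of 0] diameter_ge_0[of "U 0"] by linarith
  have cover: "A \<union> B \<subseteq> (\<Union>i. U i)"
    using U by (simp add: fine_covers_def)
  have "A \<subseteq> (\<Union>i. V i)"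
  proof
    fix x assume "x \<in> A"
    moreover obtain i where "x \<in> U i" using cover \<open>x \<in> A\<close> by blast
    ultimately show "x \<in> (\<Union>i. V i)" unfolding V_def by auto
  qed
  moreover have "B \<subseteq> (\<Union>i. W i)"
  proof
    fix x assume "x \<in> B"
    moreover obtain i where "x \<in> U i" using cover \<open>x \<in> B\<close> by blast
    ultimately show "x \<in> (\<Union>i. W i)" using disj[of i] unfolding W_def by auto
  qed
  ultimately have "hausdorff_content k \<delta> A + hausdorff_content k \<delta> B
      \<le> (\<Sum>i. diam_weight k (V i)) + (\<Sum>i. diam_weight k (W i))"
    using bU diameter_nonneg by (intro add_mono hausdorff_content_le) (auto simp: V_def W_def)
  also have "\<dots> = (\<Sum>i. diam_weight k (V i) + diam_weight k (W i))"
    by (rule suminf_add) auto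
  also have "\<dots> = (\<Sum>i. diam_weight k (U i))"
    by (rule suminf_cong) (auto simp: V_def W_def)
  finally show "hausdorff_content k \<delta> A + hausdorff_content k \<delta> B \<le> (\<Sum>i. diam_weight k (U i))" .
qed

text \<open>Contents grow as the scale shrinks, so two independent scales can both be replaced by
  one that is also below the gap \<eta>; there the contents add up, and the two suprema can then be
  taken separately.\<close>

lemma hausdorff_outer_separated:
  assumes "0 < \<eta>" and sep: "\<And>x y. x \<in> A \<Longrightarrow> y \<in> B \<Longrightarrow> \<eta> \<le> dist x y"
  shows "hausdorff_outer k A + hausdorff_outer k B \<le> hausdorff_outer k (A \<union> B)"
proof -
  have "hausdorff_content k \<delta> A + hausdorff_content k \<epsilon> B \<le> hausdorff_outer k (A \<union> B)"
    if "0 < \<delta>" "0 < \<epsilon>" for \<delta> \<epsilon>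
  proof -
    define \<zeta> where "\<zeta> = min (min \<delta> \<epsilon>) (\<eta>/2)"
    have \<zeta>: "0 < \<zeta>" "\<zeta> < \<eta>" "\<zeta> \<le> \<delta>" "\<zeta> \<le> \<epsilon>" using that assms(1) by (auto simp: \<zeta>_def)
    have "hausdorff_content k \<delta> A + hausdorff_content k \<epsilon> B
        \<le> hausdorff_content k \<zeta> A + hausdorff_content k \<zeta> B"
      by (intro add_mono hausdorff_content_antimono \<zeta>)
    also have "\<dots> \<le> hausdorff_outer k (A \<union> B)"
      using hausdorff_content_separated[OF \<zeta>(2) sep] hausdorff_content_le_outer[OF \<zeta>(1)]
      by (rule order_trans)
    finally show ?thesis .
  qed
  then show ?thesis
    unfolding hausdorff_outer_eq_SUP_content[of k A] hausdorff_outer_eq_SUP_content[of k B]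
    by (simp add: ennreal_SUP_add_left[symmetric] ennreal_SUP_add_right SUP_le_iff)
qed

lemma ennreal_suminf_tail_tendsto_0:
  fixes f :: "nat \<Rightarrow> ennreal"
  assumes fin: "(\<Sum>i. f i) < \<infinity>"
  shows "(\<lambda>n. \<Sum>i. f (i + n)) \<longlonglongrightarrow> 0"
proof -
  have "f i < \<infinity>" for i
    using ennreal_suminf_lessD[OF fin] by simp
  then have f: "f i = ennreal (enn2real (f i))" for i
    by (simp add: less_top)
  have sm: "summable (\<lambda>i. enn2real (f i))"
    using fin f by (intro summable_suminf_not_top) (auto simp: less_top)
  have "(\<Sum>i. f (i + n)) = ennreal ((\<Sum>i. enn2real (f i)) - (\<Sum>i<n. enn2real (f i)))" for n
  proof -
    have "(\<Sum>i. f (i + n)) = (\<Sum>i. ennreal (enn2real (f (i + n))))"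
      using f by simp
    also have "\<dots> = ennreal (\<Sum>i. enn2real (f (i + n)))"
      using sm by (intro suminf_ennreal2) (auto intro: summable_ignore_initial_segment)
    finally show ?thesis
      by (simp add: suminf_minus_initial_segment[OF sm])
  qed
  moreover have "(\<lambda>n. ennreal ((\<Sum>i. enn2real (f i)) - (\<Sum>i<n. enn2real (f i)))) \<longlonglongrightarrow> ennreal 0"
    by (intro tendsto_ennrealI) (use tendsto_diff[OF tendsto_const summable_LIMSEQ[OF sm], of "\<Sum>i. enn2real (f i)"] in simp)
  ultimately show ?thesis by simp
qed

text \<open>With \<open>D\<^sub>n = {x \<in> A. 1/(n+2) \<le> dist(x,F) < 1/(n+1)}\<close>, the sets of even index are mutually
  separated, and so are those of odd index. Hence \<open>\<Sum>\<^sub>n hausdorff_outer k D\<^sub>n\<close> converges and its tails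
  bound the part of \<open>A - F\<close> close to \<open>F\<close>.\<close>

lemma hausdorff_outer_closed_split:
  fixes A F :: "'a::metric_space set"
  assumes "closed F"
  shows "hausdorff_outer k (A \<inter> F) + hausdorff_outer k (A - F) \<le> hausdorff_outer k A"
proof (cases "F = {} \<or> hausdorff_outer k A = \<infinity>")
  case True
  then show ?thesis by auto
next
  case False
  then have F: "F \<noteq> {}" and finA: "hausdorff_outer k A < \<infinity>" by (auto simp: less_top)
  define h where "h = (\<lambda>x. infdist x F)"
  have h_lip: "h x \<le> h y + dist x y" for x y
    unfolding h_def by (rule infdist_triangle)
  have h0: "h x = 0" if "x \<in> F" for x using that by (simp add: h_def)
  have hpos: "0 < h x" if "x \<notin> F" for x
    using that infdist_pos_not_in_closed[OF assms F] by (simp add: h_def)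
  define D where "D = (\<lambda>n. {x\<in>A. 1 / real (n+2) \<le> h x \<and> h x < 1 / real (n+1)})"
  \<comment> \<open>\<open>E n\<close> is at distance at least \<open>1/(n+1)\<close> from
    \<open>F\<close>, so \<open>hausdorff_outer_separated\<close> applies to it and
    \<open>A \<inter> F\<close>; what it misses of \<open>A - F\<close> lies in the shells
    \<open>D i\<close> with \<open>i \<ge> n\<close>.\<close>
  define E where "E = (\<lambda>n. {x\<in>A. 1 / real (n+1) \<le> h x})"
  have gap: "hausdorff_outer k (\<Union>i\<le>n. D (2*i+c)) \<ge> (\<Sum>i\<le>n. hausdorff_outer k (D (2*i+c)))" for n c
  proof (induction n)
    case (Suc n)
    \<comment> \<open>The inner radius of shell \<open>2*n+c\<close> minus the outer radius of shell
      \<open>2*n+c+2\<close>: one whole shell of the other parity lies between them. The gap depends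
      on \<open>n\<close>, so the shells are added one at a time.\<close>
    define \<eta> where "\<eta> = 1 / real (2*n+c+2) - 1 / real (2 * Suc n+c+1)"
    have "0 < \<eta>" unfolding \<eta>_def by (auto intro!: divide_strict_left_mono)
    have "hausdorff_outer k (\<Union>i\<le>n. D (2*i+c)) + hausdorff_outer k (D (2 * Suc n+c))
        \<le> hausdorff_outer k ((\<Union>i\<le>n. D (2*i+c)) \<union> D (2 * Suc n+c))"
    proof (rule hausdorff_outer_separated[OF \<open>0 < \<eta>\<close>])
      fix x y assume "x \<in> (\<Union>i\<le>n. D (2*i+c))" and y: "y \<in> D (2 * Suc n+c)"
      then obtain i where i: "i \<le> n" "x \<in> D (2*i+c)" by blast
      have "1 / real (2*n+c+2) \<le> 1 / real (2*i+c+2)"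
        using i by (intro divide_left_mono) auto
      also have "\<dots> \<le> h x" using i(2) by (auto simp: D_def)
      finally have "1 / real (2*n+c+2) \<le> h x" .
      moreover have "h y < 1 / real (2 * Suc n+c+1)" using y unfolding D_def by blast
      ultimately show "\<eta> \<le> dist x y" using h_lip[of x y] unfolding \<eta>_def by linarith
    qed
    also have "(\<Union>i\<le>n. D (2*i+c)) \<union> D (2 * Suc n+c) = (\<Union>i\<le>Suc n. D (2*i+c))"
      by (auto simp: atMost_Suc)
    finally show ?case
      unfolding sum.atMost_Suc by (rule order_trans[OF add_right_mono[OF Suc.IH]])
  qed simp
  have "(\<Sum>i. hausdorff_outer k (D (2*i+c))) \<le> hausdorff_outer k A" for c
  proof (rule suminf_le_const)
    fix n
    have "(\<Sum>i<n. hausdorff_outer k (D (2*i+c))) \<le> (\<Sum>i\<le>n. hausdorff_outer k (D (2*i+c)))"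
      by (rule sum_mono2) auto
    also have "\<dots> \<le> hausdorff_outer k (\<Union>i\<le>n. D (2*i+c))" by (rule gap)
    also have "\<dots> \<le> hausdorff_outer k A"
      by (rule hausdorff_outer_mono) (auto simp: D_def)
    finally show "(\<Sum>i<n. hausdorff_outer k (D (2*i+c))) \<le> hausdorff_outer k A" .
  qed auto
  note half = this
  have sumfin: "(\<Sum>n. hausdorff_outer k (D n)) < \<infinity>"
  proof -
    have "(\<Sum>n. hausdorff_outer k (D n)) \<le> hausdorff_outer k A + hausdorff_outer k A"
    proof (rule suminf_le_const)
      fix n
      have "(\<Sum>i<n. hausdorff_outer k (D i)) \<le> (\<Sum>i<2*n. hausdorff_outer k (D i))"
        by (rule sum_mono2) auto
      also have "\<dots> = (\<Sum>i<n. hausdorff_outer k (D (2*i+0))) + (\<Sum>i<n. hausdorff_outer k (D (2*i+1)))"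
        by (induction n) (auto simp: algebra_simps)
      also have "\<dots> \<le> (\<Sum>i. hausdorff_outer k (D (2*i+0))) + (\<Sum>i. hausdorff_outer k (D (2*i+1)))"
        by (intro add_mono sum_le_suminf) auto
      also have "\<dots> \<le> hausdorff_outer k A + hausdorff_outer k A"
        by (intro add_mono half)
      finally show "(\<Sum>i<n. hausdorff_outer k (D i)) \<le> hausdorff_outer k A + hausdorff_outer k A" .
    qed auto
    also have "\<dots> < \<infinity>" using finA by simp
    finally show ?thesis .
  qed
  have split: "A - F \<subseteq> E n \<union> (\<Union>i. D (i + n))" for n
  proof
    fix x assume x: "x \<in> A - F"
    show "x \<in> E n \<union> (\<Union>i. D (i + n))"
    proof (cases "x \<in> E n")
      case False
      then have lt: "h x < 1 / real (n+1)" using x by (auto simp: E_def)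
      have hx: "0 < h x" using hpos x by blast
      \<comment> \<open>The least such \<open>m\<close> is the index of the shell containing
        \<open>x\<close>: minimality gives the upper bound \<open>1/(m+1)\<close>, except for
        \<open>m = n\<close>, where it comes from \<open>x\<close> not being in
        \<open>E n\<close>.\<close>
      define m where "m = (LEAST m. 1 / real (m+2) \<le> h x)"
      obtain m0 where "inverse (real (Suc m0)) < h x"
        using reals_Archimedean[OF hx] by blast
      moreover have "1 / real (m0+2) \<le> inverse (real (Suc m0))" by (simp add: field_simps)
      ultimately have "1 / real (m0+2) \<le> h x" by linarith
      then have m: "1 / real (m+2) \<le> h x" unfolding m_def by (rule LeastI)
      have nm: "n \<le> m"
      proof (rule ccontr)
        assume "\<not> n \<le> m"
        then have "1 / real (n+1) \<le> 1 / real (m+2)" by (intro divide_left_mono) auto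
        then show False using m lt by linarith
      qed
      have "h x < 1 / real (m+1)"
      proof (cases "m = n")
        case False
        then obtain l where l: "m = Suc l" using nm by (cases m) auto
        then have "\<not> 1 / real (l+2) \<le> h x"
          using not_less_Least[of l "\<lambda>m. 1 / real (m+2) \<le> h x"] unfolding m_def by auto
        then show ?thesis using l by (simp add: add.commute)
      qed (use lt in simp)
      then have "x \<in> D ((m - n) + n)" using m nm x by (auto simp: D_def)
      then show ?thesis by blast
    qed simp
  qed
  have step: "hausdorff_outer k (A \<inter> F) + hausdorff_outer k (A - F)
      \<le> hausdorff_outer k A + (\<Sum>i. hausdorff_outer k (D (i + n)))" for n
  proof -
    have "hausdorff_outer k (A - F) \<le> hausdorff_outer k (E n \<union> (\<Union>i. D (i + n)))"
      by (rule hausdorff_outer_mono[OF split])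
    also have "\<dots> \<le> hausdorff_outer k (E n) + hausdorff_outer k (\<Union>i. D (i + n))"
      by (rule hausdorff_outer_Un)
    also have "\<dots> \<le> hausdorff_outer k (E n) + (\<Sum>i. hausdorff_outer k (D (i + n)))"
      by (intro add_left_mono hausdorff_outer_UN)
    finally have 1: "hausdorff_outer k (A - F)
        \<le> hausdorff_outer k (E n) + (\<Sum>i. hausdorff_outer k (D (i + n)))" .
    have "hausdorff_outer k (A \<inter> F) + hausdorff_outer k (E n) \<le> hausdorff_outer k (A \<inter> F \<union> E n)"
    proof (rule hausdorff_outer_separated)
      fix x y assume "x \<in> A \<inter> F" "y \<in> E n"
      then show "1 / real (n+1) \<le> dist x y"
        using h_lip[of y x] h0[of x] by (auto simp: E_def dist_commute)
    qed simp
    also have "\<dots> \<le> hausdorff_outer k A"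
      by (rule hausdorff_outer_mono) (auto simp: E_def)
    finally have 2: "hausdorff_outer k (A \<inter> F) + hausdorff_outer k (E n) \<le> hausdorff_outer k A" .
    show ?thesis
      using order_trans[OF add_left_mono[OF 1] eq_refl[OF add.assoc[symmetric]]] add_right_mono[OF 2]
      by (rule order_trans)
  qed
  have "(\<lambda>n. \<Sum>i. hausdorff_outer k (D (i + n))) \<longlonglongrightarrow> 0"
    using sumfin by (rule ennreal_suminf_tail_tendsto_0)
  then have "(\<lambda>n. hausdorff_outer k A + (\<Sum>i. hausdorff_outer k (D (i + n))))
      \<longlonglongrightarrow> hausdorff_outer k A + 0"
    by (intro tendsto_add tendsto_const)
  then show ?thesis
    using step by (intro LIMSEQ_le_const[where X="\<lambda>n. hausdorff_outer k A + (\<Sum>i. hausdorff_outer k (D (i + n)))"]) auto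
qed

text \<open>Caratheodory: closed sets split every set additively, so the lambda system contains the
  Borel sets. Countable additivity on them is essential, since \<open>measure_of\<close> returns the
  zero measure when its argument is not a measure.\<close>

lemma emeasure_hausdorff_measure:
  assumes "A \<in> sets borel"
  shows "emeasure (hausdorff_measure k) A = hausdorff_outer k A"
proof -
  let ?L = "lambda_system UNIV UNIV (hausdorff_outer k :: 'a set \<Rightarrow> _)"
  interpret sigma_algebra UNIV "UNIV :: 'a set set"
    using sigma_algebra_Pow[of UNIV] by simp
  have ms: "measure_space UNIV ?L (hausdorff_outer k)"
    by (rule caratheodory_lemma[OF outer_measure_space_hausdorff])
  then interpret L: sigma_algebra UNIV ?L by (simp add: measure_space_def)
  have "F \<in> ?L" if "closed F" for F :: "'a set"
  proof -
    have "hausdorff_outer k (x \<inter> F) + hausdorff_outer k (x - F) = hausdorff_outer k x" for x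
      using hausdorff_outer_closed_split[OF that, of k x] hausdorff_outer_Un[of k "x \<inter> F" "x - F"]
      by (intro antisym) (auto simp: Int_Diff_Un)
    then show ?thesis by (simp add: lambda_system_eq)
  qed
  then have "sigma_sets UNIV (Collect closed) \<subseteq> ?L"
    by (intro L.sigma_sets_subset) auto
  then have sub: "sets borel \<subseteq> ?L"
    by (simp add: borel_eq_closed)
  have "countably_additive (sets borel) (hausdorff_outer k :: 'a set \<Rightarrow> _)"
    using ms sub unfolding measure_space_def countably_additive_def by (meson subset_trans subsetD)
  then show ?thesis
    unfolding hausdorff_measure_def using assms
    by (intro emeasure_measure_of_sigma) (auto simp: positive_def sets.sigma_algebra_axioms[of borel, simplified])
qed

lemma space_hausdorff_measure [simp]: "space (hausdorff_measure k) = UNIV"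
  by (simp add: hausdorff_measure_def space_measure_of_conv)

lemma sets_hausdorff_measure [simp, measurable_cong]: "sets (hausdorff_measure k) = sets borel"
  unfolding hausdorff_measure_def using sets.sigma_sets_eq[of borel] by simp

text \<open>A 1-Lipschitz map carries a fine cover to a fine cover with no larger diameters. This is
  the only source of invariance under rotations and under the swap of factors.\<close>

lemma hausdorff_outer_image_le:
  fixes f :: "'a::metric_space \<Rightarrow> 'b::metric_space"
  assumes f: "\<And>x y. dist (f x) (f y) \<le> dist x y"
  shows "hausdorff_outer k (f ` A) \<le> hausdorff_outer k A"
proof (rule hausdorff_outer_least)
  fix \<delta> :: real assume "0 < \<delta>"
  have "hausdorff_content k \<delta> (f ` A) \<le> hausdorff_content k \<delta> A"
    unfolding hausdorff_content_def[of k \<delta> A]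
  proof (rule INF_greatest)
    fix U assume U: "U \<in> fine_covers \<delta> A"
    have bU: "bounded (U i)" "diameter (U i) \<le> \<delta>" for i
      using U by (auto simp: fine_covers_def)
    have diam: "diameter (f ` U i) \<le> diameter (U i)" for i
      using order_trans[OF f diameter_bounded_bound[OF bU(1)]]
      by (auto simp: diameter_def[of "f ` U i"] diameter_ge_0[OF bU(1)] intro!: cSUP_least)
    have bf: "bounded (f ` U i)" for i
    proof -
      obtain x e where "U i \<subseteq> cball x e" using bU(1)[of i] by (auto simp: bounded_subset_cball)
      then have "f ` U i \<subseteq> cball (f x) e" using order_trans[OF f] by auto
      then show ?thesis using bounded_subset by blast
    qed
    have "hausdorff_content k \<delta> (f ` A) \<le> (\<Sum>i. diam_weight k (f ` U i))"
    proof (rule hausdorff_content_le)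
      have "A \<subseteq> (\<Union>i. U i)" using U by (simp add: fine_covers_def)
      then show "f ` A \<subseteq> (\<Union>i. f ` U i)" by blast
    qed (use bf order_trans[OF diam bU(2)] in auto)
    also have "\<dots> \<le> (\<Sum>i. diam_weight k (U i))"
      using diam diameter_ge_0[OF bf]
      by (intro suminf_le) (auto simp: diam_weight_def intro!: ennreal_leI power_mono)
    finally show "hausdorff_content k \<delta> (f ` A) \<le> (\<Sum>i. diam_weight k (U i))" .
  qed
  then show "hausdorff_content k \<delta> (f ` A) \<le> hausdorff_outer k A"
    using hausdorff_content_le_outer[OF \<open>0 < \<delta>\<close>] by (rule order_trans)
qed


subsection \<open>Separated sets\<close>

definition separated :: "real \<Rightarrow> 'a::metric_space set \<Rightarrow> bool" where
  "separated s P \<longleftrightarrow> (\<forall>x\<in>P. \<forall>y\<in>P. x \<noteq> y \<longrightarrow> s \<le> dist x y)"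

text \<open>Packing by volume: the balls of radius \<open>s/2\<close> about the points are disjoint
  and lie in the ball of radius \<open>R + s/2\<close>.\<close>

lemma card_separated_le:
  fixes P :: "'a::euclidean_space set"
  assumes fin: "finite P" and sep: "separated s P" and s: "0 < s" and R: "0 \<le> R" "P \<subseteq> cball 0 R"
  shows "real (card P) \<le> (1 + 2 * R / s) ^ DIM('a)"
proof -
  let ?w = "unit_ball_vol (DIM('a))"
  have "disjoint_family_on (\<lambda>x. ball x (s/2)) P"
    unfolding disjoint_family_on_def
  proof (intro ballI impI)
    fix x y assume "x \<in> P" "y \<in> P" "x \<noteq> y"
    then have "s \<le> dist x y" using sep by (auto simp: separated_def)
    then show "ball x (s/2) \<inter> ball y (s/2) = {}"
      by (intro disjoint_ballI) simp
  qed
  then have "(\<Sum>x\<in>P. emeasure lborel (ball x (s/2))) = emeasure lborel (\<Union>x\<in>P. ball x (s/2))"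
    using fin by (intro sum_emeasure) auto
  also have "\<dots> \<le> emeasure lborel (cball (0::'a) (R + s/2))"
  proof (intro emeasure_mono UN_least)
    fix x assume "x \<in> P"
    then have "dist 0 x \<le> R" using R by auto
    then have "dist 0 y \<le> R + s/2" if "dist x y < s/2" for y
      using dist_triangle[of 0 y x] that by linarith
    then show "ball x (s/2) \<subseteq> cball 0 (R + s/2)"
      by (simp only: subset_iff mem_ball mem_cball) blast
  qed simp
  finally have "ennreal (real (card P) * (?w * (s/2) ^ DIM('a))) \<le> ennreal (?w * (R + s/2) ^ DIM('a))"
    using s R by (simp add: emeasure_ball emeasure_cball ennreal_mult ennreal_of_nat_eq_real_of_nat)
  then have "real (card P) * (?w * (s/2) ^ DIM('a)) \<le> ?w * (R + s/2) ^ DIM('a)"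
    using s R by (subst (asm) ennreal_le_iff) (auto intro!: mult_nonneg_nonneg)
  then have "?w * (real (card P) * (s/2) ^ DIM('a)) \<le> ?w * (R + s/2) ^ DIM('a)"
    by (simp add: ac_simps)
  then have "real (card P) * (s/2) ^ DIM('a) \<le> (R + s/2) ^ DIM('a)"
    by (subst (asm) mult_le_cancel_left_pos) auto
  then have "real (card P) \<le> (R + s/2) ^ DIM('a) / (s/2) ^ DIM('a)"
    using s by (simp add: pos_le_divide_eq)
  also have "\<dots> = ((R + s/2) / (s/2)) ^ DIM('a)" by (rule power_divide[symmetric])
  also have "(R + s/2) / (s/2) = 1 + 2 * R / s" using s by (simp add: field_simps)
  finally show ?thesis .
qed

text \<open>The packing bound limits the cardinality of separated subsets, so a largest one exists.
  A point farther than \<open>s\<close> from all of its members could be added to it.\<close>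

lemma separated_net_exists:
  fixes S :: "'a::euclidean_space set"
  assumes "bounded S" and s: "0 < s"
  obtains P where "finite P" "P \<subseteq> S" "separated s P" "S \<subseteq> (\<Union>x\<in>P. cball x s)"
proof -
  obtain R where R: "0 < R" "S \<subseteq> cball 0 R"
    using assms(1) bounded_subset_cball[of S] by (metis bounded_subset_ballD ball_subset_cball subset_trans)
  define Q where "Q = (\<lambda>P. finite P \<and> P \<subseteq> S \<and> separated s P)"
  have "Q {}" by (simp add: Q_def separated_def)
  moreover have "card P < Suc (nat \<lceil>(1 + 2 * R / s) ^ DIM('a)\<rceil>)" if "Q P" for P
  proof -
    have "real (card P) \<le> (1 + 2 * R / s) ^ DIM('a)"
      using that R s unfolding Q_def by (intro card_separated_le) auto
    then have "card P \<le> nat \<lceil>(1 + 2 * R / s) ^ DIM('a)\<rceil>" by linarith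
    then show ?thesis by simp
  qed
  ultimately obtain P where P: "Q P" "\<And>P'. Q P' \<Longrightarrow> card P' \<le> card P"
    using ex_has_greatest_nat[of Q "{}" card] by metis
  have "S \<subseteq> (\<Union>x\<in>P. cball x s)"
  proof (rule ccontr)
    assume "\<not> ?thesis"
    then obtain y where y: "y \<in> S" "y \<notin> (\<Union>x\<in>P. cball x s)" by blast
    then have sy: "s < dist x y" if "x \<in> P" for x using that by auto
    have "y \<notin> P" using sy[of y] s by auto
    have "Q (insert y P)"
      using P(1) y(1) sy by (auto simp: Q_def separated_def dist_commute intro: less_imp_le)
    then show False using P(2)[of "insert y P"] P(1) \<open>y \<notin> P\<close> by (simp add: Q_def)
  qed
  then show ?thesis using P(1) that by (auto simp: Q_def)
qed

text \<open>About \<open>1/s\<close> scalars with spacing \<open>s\<close>. They are at least 1, so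
  multiplying by them never shrinks distances, and at most 2, so the dilates stay in a fixed
  ball.\<close>

definition unit_grid :: "real \<Rightarrow> real set" where
  "unit_grid s = (\<lambda>i. 1 + real i * s) ` {..nat \<lfloor>1 / s\<rfloor>}"

lemma unit_grid:
  assumes "0 < s"
  shows "finite (unit_grid s)" "unit_grid s \<subseteq> {1..2}" "1 / s \<le> real (card (unit_grid s))"
    and "\<And>a b. a \<in> unit_grid s \<Longrightarrow> b \<in> unit_grid s \<Longrightarrow> \<bar>a - b\<bar> < s \<Longrightarrow> a = b"
proof -
  show "finite (unit_grid s)" by (simp add: unit_grid_def)
  have "real i * s \<le> 1" if "i \<le> nat \<lfloor>1 / s\<rfloor>" for i
  proof -
    have "real i \<le> real (nat \<lfloor>1 / s\<rfloor>)" using that by simp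
    also have "\<dots> \<le> 1 / s" using assms by (simp add: of_nat_floor)
    finally have "real i \<le> 1 / s" .
    then show ?thesis using assms by (simp add: field_simps)
  qed
  then show "unit_grid s \<subseteq> {1..2}" using assms by (auto simp: unit_grid_def)
  have "inj_on (\<lambda>i. 1 + real i * s) {..nat \<lfloor>1 / s\<rfloor>}" using assms by (auto simp: inj_on_def)
  then have "card (unit_grid s) = Suc (nat \<lfloor>1 / s\<rfloor>)" by (simp add: unit_grid_def card_image)
  then show "1 / s \<le> real (card (unit_grid s))"
    using assms by simp linarith
  show "a = b" if ab: "a \<in> unit_grid s" "b \<in> unit_grid s" "\<bar>a - b\<bar> < s" for a b
  proof -
    obtain i j where ij: "a = 1 + real i * s" "b = 1 + real j * s" using ab by (auto simp: unit_grid_def)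
    then have "\<bar>real i - real j\<bar> * s < 1 * s"
      using ab(3) assms by (simp add: abs_mult left_diff_distrib[symmetric])
    then have "\<bar>real i - real j\<bar> < 1" using assms by (simp only: mult_less_cancel_right_pos)
    then have "i = j" by linarith
    then show ?thesis using ij by simp
  qed
qed

text \<open>The dilates of a separated set on the sphere by the radii of a grid are separated in the
  ball of radius 2, which turns the volume bound into the right power of \<open>s\<close>.\<close>

lemma sphere_net:
  assumes s: "0 < s" "s \<le> 1"
  obtains P where "finite P" "P \<subseteq> sphere (0::'a::euclidean_space) 1" "sphere 0 1 \<subseteq> (\<Union>x\<in>P. cball x s)"
    "real (card P) * s ^ (DIM('a) - 1) \<le> 5 ^ DIM('a)"
proof -
  obtain P where P: "finite P" "P \<subseteq> sphere (0::'a) 1" "separated s P" "sphere 0 1 \<subseteq> (\<Union>x\<in>P. cball x s)"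
    by (rule separated_net_exists[OF bounded_sphere s(1)])
  let ?G = "unit_grid s"
  define Q where "Q = (\<lambda>(a, u). a *\<^sub>R u) ` (?G \<times> P)"
  have dist_ge: "s \<le> norm (a *\<^sub>R u - b *\<^sub>R v)"
    if "a \<in> ?G" "b \<in> ?G" "u \<in> P" "v \<in> P" "(a, u) \<noteq> (b, v)" for a b u v
  proof (cases "a = b")
    case True
    have a: "1 \<le> a" using that unit_grid(2)[OF s(1)] by auto
    have "s \<le> norm (u - v)" using True that P(3) by (simp add: separated_def dist_norm)
    also have "\<dots> \<le> a * norm (u - v)" using mult_right_mono[OF a, of "norm (u - v)"] by simp
    also have "\<dots> = norm (a *\<^sub>R u - b *\<^sub>R v)" using a True by (simp add: scaleR_diff_right[symmetric])
    finally show ?thesis .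
  next
    case False
    then have "s \<le> \<bar>a - b\<bar>" using unit_grid(4)[OF s(1) that(1,2)] by linarith
    also have "\<dots> = \<bar>norm (a *\<^sub>R u) - norm (b *\<^sub>R v)\<bar>"
    proof -
      have "1 \<le> a" "1 \<le> b" "norm u = 1" "norm v = 1"
        using that P(2) unit_grid(2)[OF s(1)] by auto
      then show ?thesis by simp
    qed
    also have "\<dots> \<le> norm (a *\<^sub>R u - b *\<^sub>R v)" by (rule norm_triangle_ineq3)
    finally show ?thesis .
  qed
  have "inj_on (\<lambda>(a, u). a *\<^sub>R u) (?G \<times> P)"
  proof (rule inj_onI, clarify)
    fix a u b v assume *: "a \<in> ?G" "u \<in> P" "b \<in> ?G" "v \<in> P" "a *\<^sub>R u = b *\<^sub>R v"
    show "a = b \<and> u = v"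
    proof (rule ccontr)
      assume "\<not> ?thesis"
      then have "s \<le> norm (a *\<^sub>R u - b *\<^sub>R v)" using * by (intro dist_ge) auto
      then show False using *(5) s by simp
    qed
  qed
  then have card: "card Q = card ?G * card P" by (simp add: Q_def card_image card_cartesian_product)
  have "real (card Q) \<le> (1 + 2 * 2 / s) ^ DIM('a)"
  proof (rule card_separated_le)
    show "separated s Q"
      unfolding separated_def Q_def
    proof (clarify, unfold dist_norm)
      fix a u b v assume "a \<in> ?G" "u \<in> P" "b \<in> ?G" "v \<in> P" "a *\<^sub>R u \<noteq> b *\<^sub>R v"
      then show "s \<le> norm (a *\<^sub>R u - b *\<^sub>R v)" by (intro dist_ge) auto
    qed
    show "Q \<subseteq> cball 0 2"
    proof (unfold Q_def, clarify)
      fix a u assume "a \<in> ?G" "u \<in> P"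
      then have "1 \<le> a" "a \<le> 2" "norm u = 1" using P(2) unit_grid(2)[OF s(1)] by auto
      then show "a *\<^sub>R u \<in> cball 0 2" by simp
    qed
    show "finite Q" using P(1) unit_grid(1)[OF s(1)] by (simp add: Q_def)
  qed (use s in auto)
  also have "\<dots> \<le> (5 / s) ^ DIM('a)" using s by (intro power_mono) (auto simp: field_simps)
  finally have "real (card ?G) * real (card P) \<le> 5 ^ DIM('a) / s ^ DIM('a)" by (simp add: card power_divide)
  moreover have "1 / s * real (card P) \<le> real (card ?G) * real (card P)"
    by (intro mult_right_mono unit_grid s) auto
  ultimately have "1 / s * real (card P) \<le> 5 ^ DIM('a) / s ^ DIM('a)" by linarith
  moreover have "s ^ DIM('a) = s * s ^ (DIM('a) - 1)"
    by (metis DIM_positive power_eq_if less_numeral_extra(3))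
  ultimately have "real (card P) * s ^ (DIM('a) - 1) \<le> 5 ^ DIM('a)"
    using s by (simp add: field_simps)
  then show ?thesis using that P by blast
qed


subsection \<open>The Hausdorff measure of the triangle manifold\<close>

lemma triangle_manifold_iff_inner:
  "(u, v) \<in> triangle_manifold \<longleftrightarrow> u \<bullet> u = 1 \<and> v \<bullet> v = 1 \<and> u \<bullet> v = 1 / 2"
proof -
  have "norm (u - v) = 1 \<longleftrightarrow> u \<bullet> u + v \<bullet> v - 2 * (u \<bullet> v) = 1"
    by (simp add: norm_eq_1 inner_diff_left inner_diff_right inner_commute algebra_simps)
  then show ?thesis
    by (auto simp: triangle_manifold_def norm_eq_1)
qed

lemma closed_triangle_manifold: "closed (triangle_manifold :: ((real ^ 'n) \<times> (real ^ 'n)) set)"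
proof -
  have eq: "(triangle_manifold :: ((real ^ 'n) \<times> (real ^ 'n)) set) = {z. norm (fst z) = 1} \<inter>
      {z. norm (snd z) = 1} \<inter> {z. norm (fst z - snd z) = 1}"
    by (auto simp: triangle_manifold_def)
  show ?thesis
    unfolding eq by (intro closed_Int closed_Collect_eq continuous_intros)
qed

lemma bounded_triangle_manifold: "bounded (triangle_manifold :: ((real ^ 'n) \<times> (real ^ 'n)) set)"
proof -
  have "triangle_manifold \<subseteq> sphere (0::real ^ 'n) 1 \<times> sphere 0 1"
    by (auto simp: triangle_manifold_def)
  then show ?thesis
    by (rule bounded_subset[rotated]) (intro bounded_Times bounded_sphere)
qed

text \<open>The finite family is padded with empty sets, whose weight is 0 for every
  \<open>k\<close>, to form the infinite sequence that the content requires.\<close>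

lemma hausdorff_content_finite_cover:
  assumes "finite P" "A \<subseteq> (\<Union>x\<in>P. cball x s)" "0 < s"
  shows "hausdorff_content k (2 * s) A \<le> ennreal (real (card P) * (2 * s) ^ k)"
proof -
  obtain h where h: "bij_betw h {0..<card P} P"
    using ex_bij_betw_nat_finite[OF assms(1)] by blast
  define U where "U = (\<lambda>i. if i < card P then cball (h i) s else {})"
  have U_diam: "diameter (U i) \<le> 2 * s" for i
    using assms(3) by (cases "U i = {}") (auto simp: U_def diameter_def dist_commute intro!: cSUP_least
      order_trans[OF dist_triangle2[of _ _ "h i"]])
  have bU: "bounded (U i)" for i by (simp add: U_def)
  have "A \<subseteq> (\<Union>i. U i)"
  proof
    fix x assume "x \<in> A"
    then obtain p where p: "p \<in> P" "x \<in> cball p s" using assms(2) by blast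
    obtain i where "i < card P" "h i = p" using bij_betw_imp_surj_on[OF h] p(1) by (metis atLeastLessThan_iff imageE)
    then show "x \<in> (\<Union>i. U i)" using p(2) by (auto simp: U_def)
  qed
  then have "hausdorff_content k (2 * s) A \<le> (\<Sum>i. diam_weight k (U i))"
    using U_diam bU by (intro hausdorff_content_le)
  also have "\<dots> = (\<Sum>i<card P. diam_weight k (U i))"
    by (rule suminf_finite) (auto simp: U_def)
  also have "\<dots> \<le> (\<Sum>i<card P. ennreal ((2 * s) ^ k))"
    using ennreal_leI[OF power_mono[OF U_diam diameter_ge_0[OF bU]], of _ k]
    by (intro sum_mono) (simp add: diam_weight_def del: power_mult_distrib)
  also have "\<dots> = ennreal (real (card P) * (2 * s) ^ k)"
    using assms(3) by (simp add: ennreal_mult ennreal_of_nat_eq_real_of_nat)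
  finally show ?thesis .
qed

text \<open>Three scalar parameters turn a separated subset of the manifold into a separated subset of
  the ambient space of dimension \<open>2d\<close>; they can be read off the pair \<open>(a, b)\<close> since \<open>2v - u\<close> is
  orthogonal to \<open>u\<close> and has length \<open>\<surd>3\<close>.\<close>

lemma triangle_parametrization_separated:
  assumes M: "(u, v) \<in> triangle_manifold" "(u', v') \<in> triangle_manifold" and s: "0 < s"
    and ge: "1 \<le> \<alpha>" "1 \<le> \<alpha>'" "1 \<le> \<beta>" "\<beta> \<le> 2" "1 \<le> \<beta>'" "\<beta>' \<le> 2" "1 \<le> \<gamma>" "\<gamma> \<le> 2" "1 \<le> \<gamma>'" "\<gamma>' \<le> 2"
    and grid: "\<bar>\<alpha> - \<alpha>'\<bar> < s \<Longrightarrow> \<alpha> = \<alpha>'" "\<bar>\<beta> - \<beta>'\<bar> < s \<Longrightarrow> \<beta> = \<beta>'" "\<bar>\<gamma> - \<gamma>'\<bar> < s \<Longrightarrow> \<gamma> = \<gamma>'"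
    and close: "dist (\<alpha> *\<^sub>R u, \<beta> *\<^sub>R u + \<gamma> *\<^sub>R (2 *\<^sub>R v - u)) (\<alpha>' *\<^sub>R u', \<beta>' *\<^sub>R u' + \<gamma>' *\<^sub>R (2 *\<^sub>R v' - u')) < s / 8"
  shows "\<alpha> = \<alpha>' \<and> \<beta> = \<beta>' \<and> \<gamma> = \<gamma>' \<and> dist (u, v) (u', v') < s"
proof -
  define y y' where "y = 2 *\<^sub>R v - u" and "y' = 2 *\<^sub>R v' - u'"
  define b b' where "b = \<beta> *\<^sub>R u + \<gamma> *\<^sub>R y" and "b' = \<beta>' *\<^sub>R u' + \<gamma>' *\<^sub>R y'"
  have in1: "u \<bullet> u = 1" "v \<bullet> v = 1" "u \<bullet> v = 1/2" "v \<bullet> u = 1/2"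
    and in2: "u' \<bullet> u' = 1" "v' \<bullet> v' = 1" "u' \<bullet> v' = 1/2" "v' \<bullet> u' = 1/2"
    using M by (auto simp: triangle_manifold_iff_inner inner_commute)
  have nu: "norm u = 1" "norm u' = 1" using in1 in2 by (auto simp: norm_eq_1)
  have ny: "norm y = sqrt 3" "norm y' = sqrt 3"
    using in1 in2 by (auto simp: norm_eq_sqrt_inner y_def y'_def inner_diff_left inner_diff_right)
  have uy: "u \<bullet> y = 0" "u' \<bullet> y' = 0"
    using in1 in2 by (auto simp: y_def y'_def inner_diff_left inner_diff_right)
  have sqrt3: "1 \<le> sqrt 3" "sqrt 3 \<le> 2" by (auto intro: real_le_rsqrt real_le_lsqrt)
  have da: "norm (\<alpha> *\<^sub>R u - \<alpha>' *\<^sub>R u') < s / 8" and db: "norm (b - b') < s / 8"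
    using close norm_fst_le[of "\<alpha> *\<^sub>R u - \<alpha>' *\<^sub>R u'" "b - b'"] norm_snd_le[of "b - b'" "\<alpha> *\<^sub>R u - \<alpha>' *\<^sub>R u'"]
    by (auto simp: dist_norm b_def b'_def y_def y'_def)
  have "\<bar>\<alpha> - \<alpha>'\<bar> = \<bar>norm (\<alpha> *\<^sub>R u) - norm (\<alpha>' *\<^sub>R u')\<bar>" using nu ge by simp
  also have "\<dots> < s" using norm_triangle_ineq3[of "\<alpha> *\<^sub>R u" "\<alpha>' *\<^sub>R u'"] da s by linarith
  finally have \<alpha>: "\<alpha> = \<alpha>'" by (rule grid)
  have "norm (u - u') \<le> \<alpha> * norm (u - u')" using mult_right_mono[OF ge(1), of "norm (u - u')"] by simp
  also have "\<dots> = norm (\<alpha> *\<^sub>R u - \<alpha>' *\<^sub>R u')" using ge \<alpha> by (simp add: scaleR_diff_right[symmetric])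
  finally have du: "norm (u - u') < s / 8" using da by linarith
  have "norm b' \<le> \<beta>' * 1 + \<gamma>' * sqrt 3"
    unfolding b'_def using ge norm_triangle_ineq[of "\<beta>' *\<^sub>R u'" "\<gamma>' *\<^sub>R y'"] nu ny by simp
  also have "\<dots> \<le> 2 * 1 + 2 * 2" using ge sqrt3 by (intro add_mono mult_mono) auto
  finally have nb': "norm b' \<le> 6" by simp
  \<comment> \<open>By orthogonality \<beta> is \<open>b \<bullet> u\<close>. The resulting error is
    below \<open>s/8 + 6 * s/8 < s\<close>, which explains the closeness threshold
    \<open>s/8\<close>.\<close>
  have "\<beta> - \<beta>' = (b - b') \<bullet> u + b' \<bullet> (u - u')"
    using in1 in2 uy by (simp add: b_def b'_def inner_add_left inner_diff_left inner_diff_right inner_add_right inner_commute algebra_simps)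
  also have "\<bar>\<dots>\<bar> \<le> norm (b - b') * norm u + norm b' * norm (u - u')"
    by (intro order_trans[OF abs_triangle_ineq] add_mono Cauchy_Schwarz_ineq2)
  also have "\<dots> \<le> norm (b - b') + 6 * norm (u - u')"
    using nb' nu by (simp add: mult_right_mono)
  also have "\<dots> < s" using db du s by linarith
  finally have \<beta>: "\<beta> = \<beta>'" by (rule grid)
  \<comment> \<open>With equal \<beta>, subtracting the \<open>u\<close> part from \<open>b\<close>
    leaves the multiple of \<open>y\<close>. Its length determines \<gamma> because
    \<open>norm y = sqrt 3\<close> is fixed and at least 1; finally \<open>v\<close> is half of
    \<open>y + u\<close>.\<close>
  have "norm (\<gamma> *\<^sub>R y - \<gamma>' *\<^sub>R y') = norm ((b - b') - \<beta> *\<^sub>R (u - u'))"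
    by (rule arg_cong[where f=norm]) (simp add: b_def b'_def \<beta> algebra_simps)
  also have "\<dots> \<le> norm (b - b') + \<beta> * norm (u - u')"
    using norm_triangle_ineq4[of "b - b'" "\<beta> *\<^sub>R (u - u')"] ge by simp
  also have "\<dots> \<le> norm (b - b') + 2 * norm (u - u')"
    using ge by (intro add_left_mono mult_right_mono) auto
  finally have dy: "norm (\<gamma> *\<^sub>R y - \<gamma>' *\<^sub>R y') < 3 * s / 8" using db du by linarith
  have "\<bar>\<gamma> - \<gamma>'\<bar> * 1 \<le> \<bar>\<gamma> - \<gamma>'\<bar> * sqrt 3" using sqrt3 by (intro mult_left_mono) auto
  also have "\<dots> = \<bar>norm (\<gamma> *\<^sub>R y) - norm (\<gamma>' *\<^sub>R y')\<bar>"
    using ny ge by (simp add: left_diff_distrib[symmetric] abs_mult)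
  also have "\<dots> < s" using norm_triangle_ineq3[of "\<gamma> *\<^sub>R y" "\<gamma>' *\<^sub>R y'"] dy s by linarith
  finally have \<gamma>: "\<gamma> = \<gamma>'" using grid(3) by simp
  have "norm (y - y') \<le> \<gamma> * norm (y - y')" using mult_right_mono[OF ge(7), of "norm (y - y')"] by simp
  also have "\<dots> = norm (\<gamma> *\<^sub>R y - \<gamma>' *\<^sub>R y')" using ge \<gamma> by (simp add: scaleR_diff_right[symmetric])
  finally have dy': "norm (y - y') < 3 * s / 8" using dy by linarith
  have "2 * norm (v - v') = norm (2 *\<^sub>R (v - v'))" by simp
  also have "2 *\<^sub>R (v - v') = (y - y') + (u - u')"
    by (simp add: y_def y'_def algebra_simps)
  also have "norm \<dots> < s / 2" using norm_triangle_ineq[of "y - y'" "u - u'"] dy' du by linarith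
  finally have "norm (v - v') < s / 4" by simp
  then have "dist (u, v) (u', v') < s"
    using norm_Pair_le[of "u - u'" "v - v'"] du s by (simp add: dist_norm)
  then show ?thesis using \<alpha> \<beta> \<gamma> by blast
qed

text \<open>The three grids multiply the number of points by at least \<open>s^-3\<close>, and
  packing in dimension 2d allows \<open>(129/s)^(2d)\<close> of them, so exponent 2d-3 remains. Here
  129 = 1 + 2*8*8 comes from the ball radius 8 and the separation \<open>s/8\<close>.\<close>

lemma card_separated_triangle_manifold_le:
  fixes P :: "((real ^ 'n) \<times> (real ^ 'n)) set"
  assumes P: "finite P" "P \<subseteq> triangle_manifold" "separated s P" and s: "0 < s" "s \<le> 1" and d: "CARD('n) \<ge> 2"
  shows "real (card P) * s ^ (2 * CARD('n) - 3) \<le> 129 ^ (2 * CARD('n))"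
proof -
  let ?G = "unit_grid s"
  define \<Psi> where "\<Psi> = (\<lambda>(\<alpha>, \<beta>, \<gamma>, u :: real ^ 'n, v :: real ^ 'n). (\<alpha> *\<^sub>R u, \<beta> *\<^sub>R u + \<gamma> *\<^sub>R (2 *\<^sub>R v - u)))"
  define X where "X = ?G \<times> ?G \<times> ?G \<times> P"
  have G: "1 \<le> a \<and> a \<le> 2" if "a \<in> ?G" for a using unit_grid(2)[OF s(1)] that by auto
  have sep: "x = y" if "x \<in> X" "y \<in> X" "dist (\<Psi> x) (\<Psi> y) < s / 8" for x y
  proof -
    obtain \<alpha> \<beta> \<gamma> u v where x: "x = (\<alpha>, \<beta>, \<gamma>, u, v)" by (cases x) auto
    obtain \<alpha>' \<beta>' \<gamma>' u' v' where y: "y = (\<alpha>', \<beta>', \<gamma>', u', v')" by (cases y) auto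
    have in1: "\<alpha> \<in> ?G" "\<beta> \<in> ?G" "\<gamma> \<in> ?G" "(u, v) \<in> P" using that(1) by (auto simp: X_def x)
    have in2: "\<alpha>' \<in> ?G" "\<beta>' \<in> ?G" "\<gamma>' \<in> ?G" "(u', v') \<in> P" using that(2) by (auto simp: X_def y)
    have "\<alpha> = \<alpha>' \<and> \<beta> = \<beta>' \<and> \<gamma> = \<gamma>' \<and> dist (u, v) (u', v') < s"
    proof (rule triangle_parametrization_separated)
      show "(u, v) \<in> triangle_manifold" "(u', v') \<in> triangle_manifold" using in1 in2 P(2) by auto
    qed (use in1 in2 G unit_grid(4)[OF s(1)] s that(3) in \<open>auto simp: \<Psi>_def x y\<close>)
    moreover from this have "(u, v) = (u', v')"
      using P(3) in1 in2 unfolding separated_def by (meson not_le)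
    ultimately show ?thesis by (simp add: x y)
  qed
  have inj: "inj_on \<Psi> X" using sep s by (auto simp: inj_on_def)
  have fin: "finite (\<Psi> ` X)" using unit_grid(1)[OF s(1)] P(1) by (simp add: X_def)
  have bnd: "\<Psi> ` X \<subseteq> cball 0 8"
  proof (clarsimp simp: X_def \<Psi>_def)
    fix \<alpha> \<beta> \<gamma> u v assume *: "\<alpha> \<in> ?G" "\<beta> \<in> ?G" "\<gamma> \<in> ?G" "(u, v) \<in> P"
    have nuv: "norm u = 1" "norm v = 1" "norm (v - u) = 1"
      using P(2) * by (auto simp: triangle_manifold_def norm_minus_commute)
    have "norm (2 *\<^sub>R v - u) = norm (v + (v - u))" by (rule arg_cong[where f=norm]) (simp add: scaleR_2)
    also have "\<dots> \<le> 2" using norm_triangle_ineq[of v "v - u"] nuv by linarith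
    finally have ny: "norm (2 *\<^sub>R v - u) \<le> 2" .
    have "norm (\<beta> *\<^sub>R u + \<gamma> *\<^sub>R (2 *\<^sub>R v - u)) \<le> \<beta> * 1 + \<gamma> * norm (2 *\<^sub>R v - u)"
      using norm_triangle_ineq[of "\<beta> *\<^sub>R u" "\<gamma> *\<^sub>R (2 *\<^sub>R v - u)"] nuv G[OF *(2)] G[OF *(3)] by simp
    also have "\<dots> \<le> 2 * 1 + 2 * 2"
      using G[OF *(2)] G[OF *(3)] ny by (intro add_mono mult_mono) auto
    finally have "norm (\<beta> *\<^sub>R u + \<gamma> *\<^sub>R (2 *\<^sub>R v - u)) \<le> 6" by simp
    moreover have "norm (\<alpha> *\<^sub>R u) \<le> 2" using nuv G[OF *(1)] by simp
    ultimately show "norm (\<alpha> *\<^sub>R u, \<beta> *\<^sub>R u + \<gamma> *\<^sub>R (2 *\<^sub>R v - u)) \<le> 8"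
      using norm_Pair_le[of "\<alpha> *\<^sub>R u" "\<beta> *\<^sub>R u + \<gamma> *\<^sub>R (2 *\<^sub>R v - u)"] by linarith
  qed
  have "real (card (\<Psi> ` X)) \<le> (1 + 2 * 8 / (s / 8)) ^ DIM((real ^ 'n) \<times> (real ^ 'n))"
  proof (rule card_separated_le[OF fin])
    show "separated (s / 8) (\<Psi> ` X)"
      unfolding separated_def using sep by (metis (no_types, lifting) imageE not_le)
  qed (use s bnd in auto)
  also have "\<dots> \<le> (129 / s) ^ DIM((real ^ 'n) \<times> (real ^ 'n))"
    using s by (intro power_mono) (auto simp: field_simps)
  also have "\<dots> = 129 ^ (2 * CARD('n)) / s ^ (2 * CARD('n))"
    by (simp add: power_divide mult_2)
  also have "card (\<Psi> ` X) = card ?G ^ 3 * card P"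
    using inj by (simp add: card_image) (simp add: X_def card_cartesian_product power3_eq_cube)
  finally have "real (card ?G) ^ 3 * real (card P) \<le> 129 ^ (2 * CARD('n)) / s ^ (2 * CARD('n))"
    by simp
  moreover have "(1 / s) ^ 3 * real (card P) \<le> real (card ?G) ^ 3 * real (card P)"
    using s by (intro mult_right_mono power_mono unit_grid) auto
  ultimately have le: "(1 / s) ^ 3 * real (card P) \<le> 129 ^ (2 * CARD('n)) / s ^ (2 * CARD('n))"
    by linarith
  have "2 * CARD('n) = 3 + (2 * CARD('n) - 3)" using d by simp
  then have pw: "s ^ (2 * CARD('n)) = s ^ 3 * s ^ (2 * CARD('n) - 3)" by (metis power_add)
  show ?thesis using le s unfolding pw by (simp add: field_simps)
qed

text \<open>A maximal separated subset is also a cover by balls, and the counting bound makes its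
  total weight bounded independently of the scale.\<close>

lemma hausdorff_outer_triangle_manifold_finite:
  assumes d: "CARD('n) \<ge> 2"
  shows "hausdorff_outer (2 * CARD('n) - 3) (triangle_manifold :: ((real ^ 'n) \<times> (real ^ 'n)) set) < \<infinity>"
proof -
  let ?k = "2 * CARD('n) - 3" and ?M = "triangle_manifold :: ((real ^ 'n) \<times> (real ^ 'n)) set"
  have "hausdorff_outer ?k ?M \<le> ennreal (2 ^ ?k * 129 ^ (2 * CARD('n)))"
  proof (rule hausdorff_outer_least)
    fix \<delta> :: real assume "0 < \<delta>"
    define s where "s = min 1 (\<delta> / 2)"
    have s: "0 < s" "s \<le> 1" "2 * s \<le> \<delta>" using \<open>0 < \<delta>\<close> by (auto simp: s_def)
    obtain P where P: "finite P" "P \<subseteq> ?M" "separated s P" "?M \<subseteq> (\<Union>x\<in>P. cball x s)"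
      using separated_net_exists[OF bounded_triangle_manifold s(1)] by metis
    have "hausdorff_content ?k \<delta> ?M \<le> hausdorff_content ?k (2 * s) ?M"
      by (rule hausdorff_content_antimono[OF s(3)])
    also have "\<dots> \<le> ennreal (real (card P) * (2 * s) ^ ?k)"
      by (rule hausdorff_content_finite_cover[OF P(1,4) s(1)])
    also have "\<dots> \<le> ennreal (2 ^ ?k * 129 ^ (2 * CARD('n)))"
      using card_separated_triangle_manifold_le[OF P(1-3) s(1,2) d]
      by (intro ennreal_leI) (simp add: power_mult_distrib mult.left_commute)
    finally show "hausdorff_content ?k \<delta> ?M \<le> ennreal (2 ^ ?k * 129 ^ (2 * CARD('n)))" .
  qed
  then show ?thesis by (rule le_less_trans) simp
qed


text \<open>The same parametrization, with parameters in \<open>[-2, 2]\<close> and without the orthogonality, covers the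
  unit ball of the ambient space.\<close>

lemma triangle_parametrization_covers:
  fixes a b :: "real ^ 'n"
  assumes ab: "norm a \<le> 1" "norm b \<le> 1" and d: "CARD('n) \<ge> 2"
  obtains \<alpha> \<beta> \<gamma> u v where "(u, v) \<in> triangle_manifold" "\<bar>\<alpha>\<bar> \<le> 2" "\<bar>\<beta>\<bar> \<le> 2" "\<bar>\<gamma>\<bar> \<le> 2"
    "a = \<alpha> *\<^sub>R u" "b = \<beta> *\<^sub>R u + \<gamma> *\<^sub>R v"
proof -
  have unit: "\<exists>u. norm u = 1 \<and> x = norm x *\<^sub>R u" if "y \<noteq> 0" for x y :: "real ^ 'n"
  proof (cases "x = 0")
    case True
    then show ?thesis using that by (intro exI[of _ "y /\<^sub>R norm y"]) simp
  next
    case False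
    then show ?thesis by (intro exI[of _ "x /\<^sub>R norm x"]) simp
  qed
  \<comment> \<open>Any nonzero vector serves: it supplies a direction \<open>u\<close> when
    \<open>a = 0\<close>.\<close>
  have "axis undefined 1 \<noteq> (0 :: real ^ 'n)" by (simp add: axis_eq_0_iff)
  then obtain u where u: "norm u = 1" "a = norm a *\<^sub>R u" using unit by blast
  define x where "x = b - (b \<bullet> u) *\<^sub>R u"
  have uu: "u \<bullet> u = 1" using u by (simp add: norm_eq_1)
  have xu: "x \<bullet> u = 0" by (simp add: x_def inner_diff_left uu)
  \<comment> \<open>If \<open>b\<close> is parallel to \<open>u\<close>, the direction
    \<open>w\<close> has to be invented, which takes dimension at least 2.\<close>
  obtain w where w: "norm w = 1" "x = norm x *\<^sub>R w" "w \<bullet> u = 0"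
  proof (cases "x = 0")
    case True
    obtain z where z: "z \<noteq> 0" "orthogonal u z"
      using orthogonal_to_vector_exists[of u] d by auto
    show ?thesis
      using z True by (intro that[of "z /\<^sub>R norm z"]) (auto simp: orthogonal_def inner_commute)
  next
    case False
    then show ?thesis using xu by (intro that[of "x /\<^sub>R norm x"]) auto
  qed
  have ww: "w \<bullet> w = 1" using w by (simp add: norm_eq_1)
  have wu: "u \<bullet> w = 0" using w(3) by (simp add: inner_commute)
  \<comment> \<open>\<open>v\<close> is \<open>u\<close> turned by 60 degrees towards
    \<open>w\<close>. Conversely \<open>w\<close> is \<open>2v - u\<close> divided by
    \<open>sqrt 3\<close>, whence the coefficients \<open>b \<bullet> u - c\<close> and
    \<open>2 * c\<close> of \<open>b\<close> below.\<close>
  define v where "v = (1/2) *\<^sub>R u + (sqrt 3 / 2) *\<^sub>R w"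
  have uv: "u \<bullet> v = 1/2" by (simp add: v_def inner_add_right uu wu)
  have vv: "v \<bullet> v = 1"
    by (simp add: v_def inner_add_left inner_add_right uu wu w(3) ww field_simps)
  have nx: "norm x \<le> 1"
  proof -
    have "b \<bullet> b = x \<bullet> x + (b \<bullet> u)\<^sup>2"
      using xu uu by (simp add: x_def inner_diff_left inner_diff_right power2_eq_square inner_commute)
    then have "(norm x)\<^sup>2 \<le> (norm b)\<^sup>2" by (simp add: dot_square_norm[symmetric])
    then show ?thesis using ab(2) by (meson norm_ge_zero order_trans power2_le_imp_le)
  qed
  have bu: "\<bar>b \<bullet> u\<bar> \<le> 1" using Cauchy_Schwarz_ineq2[of b u] u ab by simp
  have sqrt3: "1 \<le> sqrt 3" by simp
  then have "norm x \<le> sqrt 3" using nx by linarith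
  define c where "c = norm x / sqrt 3"
  have c: "0 \<le> c" "c \<le> 1" using \<open>norm x \<le> sqrt 3\<close> by (auto simp: c_def)
  have "b = (b \<bullet> u) *\<^sub>R u + norm x *\<^sub>R w" using w(2) by (simp add: x_def)
  also have "norm x *\<^sub>R w = (2 * c) *\<^sub>R v - c *\<^sub>R u"
    by (simp add: v_def c_def scaleR_add_right)
  finally have "b = (b \<bullet> u - c) *\<^sub>R u + (2 * c) *\<^sub>R v" by (simp add: algebra_simps)
  then show ?thesis
    using that[of u v "norm a" "b \<bullet> u - c" "2 * c"] u(2) ab c bu uu uv vv
    by (simp add: triangle_manifold_iff_inner)
qed

text \<open>Each product of a scalar and a vector moves by at most \<open>3 * s\<close>; three such
  products occur, hence 9.\<close>

lemma triangle_parametrization_lipschitz: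
  fixes u v :: "'a::real_inner"
  assumes uv: "norm u \<le> 1" "norm v \<le> 1" and d: "dist (u, v) (u', v') \<le> s"
    and le: "\<bar>\<alpha>'\<bar> \<le> 2" "\<bar>\<beta>'\<bar> \<le> 2" "\<bar>\<gamma>'\<bar> \<le> 2" "\<bar>\<alpha> - \<alpha>'\<bar> \<le> s" "\<bar>\<beta> - \<beta>'\<bar> \<le> s" "\<bar>\<gamma> - \<gamma>'\<bar> \<le> s"
  shows "dist (\<alpha> *\<^sub>R u, \<beta> *\<^sub>R u + \<gamma> *\<^sub>R v) (\<alpha>' *\<^sub>R u', \<beta>' *\<^sub>R u' + \<gamma>' *\<^sub>R v') \<le> 9 * s"
proof -
  have duv: "norm (u - u') \<le> s" "norm (v - v') \<le> s"
    using d norm_fst_le[of "u - u'" "v - v'"] norm_snd_le[of "v - v'" "u - u'"] by (auto simp: dist_norm)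
  have scaled: "norm (t *\<^sub>R z - t' *\<^sub>R z') \<le> 3 * s"
    if "norm z \<le> 1" "norm (z - z') \<le> s" "\<bar>t'\<bar> \<le> 2" "\<bar>t - t'\<bar> \<le> s" for t t' and z z' :: 'a
  proof -
    have "t *\<^sub>R z - t' *\<^sub>R z' = (t - t') *\<^sub>R z + t' *\<^sub>R (z - z')" by (simp add: algebra_simps)
    also have "norm \<dots> \<le> \<bar>t - t'\<bar> * norm z + \<bar>t'\<bar> * norm (z - z')"
      using norm_triangle_ineq[of "(t - t') *\<^sub>R z" "t' *\<^sub>R (z - z')"] by simp
    also have "\<dots> \<le> s * 1 + 2 * s" using that by (intro add_mono mult_mono) auto
    finally show ?thesis by simp
  qed
  have "norm (\<beta> *\<^sub>R u + \<gamma> *\<^sub>R v - (\<beta>' *\<^sub>R u' + \<gamma>' *\<^sub>R v')) \<le> 3 * s + 3 * s"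
    using norm_diff_triangle_ineq[of "\<beta> *\<^sub>R u" "\<gamma> *\<^sub>R v" "\<beta>' *\<^sub>R u'" "\<gamma>' *\<^sub>R v'"]
      scaled[of u u' \<beta>' \<beta>] scaled[of v v' \<gamma>' \<gamma>] uv duv le by linarith
  then show ?thesis
    using scaled[of u u' \<alpha>' \<alpha>] uv duv le
      norm_Pair_le[of "\<alpha> *\<^sub>R u - \<alpha>' *\<^sub>R u'" "\<beta> *\<^sub>R u + \<gamma> *\<^sub>R v - (\<beta>' *\<^sub>R u' + \<gamma>' *\<^sub>R v')"]
    by (simp add: dist_norm)
qed

lemma interval_grid_exists:
  assumes s: "0 < s" "s \<le> (1::real)"
  obtains L where "finite L" "real (card L) \<le> 5 / s" "L \<subseteq> {-2..2}"
    "\<And>t. \<bar>t\<bar> \<le> 2 \<Longrightarrow> \<exists>t'\<in>L. \<bar>t - t'\<bar> \<le> s"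
proof -
  define L where "L = (\<lambda>i. -2 + real i * s) ` {..nat \<lfloor>4 / s\<rfloor>}"
  have "card L \<le> Suc (nat \<lfloor>4 / s\<rfloor>)"
    unfolding L_def by (rule order_trans[OF card_image_le]) auto
  then have "real (card L) \<le> real (nat \<lfloor>4 / s\<rfloor>) + 1" by simp
  also have "real (nat \<lfloor>4 / s\<rfloor>) \<le> 4 / s" using s by (simp add: of_nat_floor)
  also have "4 / s + 1 \<le> 5 / s" using s by (simp add: field_simps)
  finally have "real (card L) \<le> 5 / s" by simp
  moreover have "L \<subseteq> {-2..2}"
  proof -
    have "real i * s \<le> 4" if "i \<le> nat \<lfloor>4 / s\<rfloor>" for i
    proof -
      have "real i \<le> real (nat \<lfloor>4 / s\<rfloor>)" using that by simp
      also have "\<dots> \<le> 4 / s" using s by (simp add: of_nat_floor)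
      finally show ?thesis using s by (simp add: field_simps)
    qed
    then show ?thesis using s by (auto simp: L_def)
  qed
  moreover have "\<exists>t'\<in>L. \<bar>t - t'\<bar> \<le> s" if "\<bar>t\<bar> \<le> 2" for t
  proof -
    define i where "i = nat \<lfloor>(t + 2) / s\<rfloor>"
    have nn: "0 \<le> (t + 2) / s" using that s by simp
    have "(t + 2) / s \<le> 4 / s" using that s by (intro divide_right_mono) auto
    then have "i \<le> nat \<lfloor>4 / s\<rfloor>" unfolding i_def by (intro nat_mono floor_mono)
    moreover have "real i \<le> (t + 2) / s" "(t + 2) / s < real i + 1" using nn unfolding i_def by linarith+
    then have "\<bar>t - (-2 + real i * s)\<bar> \<le> s" using s by (simp add: field_simps)
    ultimately show ?thesis by (auto simp: L_def)
  qed
  ultimately show ?thesis using that[of L] by (auto simp: L_def)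
qed

text \<open>A piece of size \<open>s i\<close>, combined with three parameter grids of at most
  \<open>5 / s i\<close> points, yields at most \<open>(5 / s i)^3\<close> balls of radius
  \<open>9 * s i\<close>, and together these cover the unit ball of the ambient space. Comparing
  volumes gives the constant 125 * 9^(2d) and the exponent 2d-3. Separate sizes \<open>s i\<close>
  are used, instead of diameters, because they must be positive.\<close>

lemma triangle_manifold_cover_lower_bound:
  fixes U :: "nat \<Rightarrow> ((real ^ 'n) \<times> (real ^ 'n)) set"
  assumes cover: "triangle_manifold \<subseteq> (\<Union>i. U i)"
    and diam: "\<And>i x y. x \<in> U i \<Longrightarrow> y \<in> U i \<Longrightarrow> dist x y \<le> s i"
    and s: "\<And>i. 0 < s i" "\<And>i. s i \<le> 1" and d: "CARD('n) \<ge> 2"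
  shows "1 \<le> ennreal (125 * 9 ^ (2 * CARD('n))) * (\<Sum>i. ennreal (s i ^ (2 * CARD('n) - 3)))"
proof -
  let ?D = "DIM((real ^ 'n) \<times> (real ^ 'n))"
  let ?w = "unit_ball_vol ?D"
  define \<Phi> where "\<Phi> = (\<lambda>\<alpha> \<beta> \<gamma> (u :: real ^ 'n, v :: real ^ 'n). (\<alpha> *\<^sub>R u, \<beta> *\<^sub>R u + \<gamma> *\<^sub>R v))"
  have "\<exists>L. finite L \<and> real (card L) \<le> 5 / s i \<and> L \<subseteq> {-2..2} \<and> (\<forall>t. \<bar>t\<bar> \<le> 2 \<longrightarrow> (\<exists>t'\<in>L. \<bar>t - t'\<bar> \<le> s i))" for i
    using interval_grid_exists[OF s(1)[of i] s(2)[of i]] by metis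
  then obtain L where L: "\<And>i. finite (L i)" "\<And>i. real (card (L i)) \<le> 5 / s i" "\<And>i. L i \<subseteq> {-2..2}"
    "\<And>i t. \<bar>t\<bar> \<le> 2 \<Longrightarrow> \<exists>t'\<in>L i. \<bar>t - t'\<bar> \<le> s i"
    by metis
  define m where "m = (\<lambda>i. SOME x. x \<in> U i)"
  define B where "B = (\<lambda>i. (\<lambda>(\<alpha>, \<beta>, \<gamma>). \<Phi> \<alpha> \<beta> \<gamma> (m i)) ` (L i \<times> L i \<times> L i))"
  have finB: "finite (B i)" for i using L(1) by (simp add: B_def)
  have cardB: "real (card (B i)) \<le> (5 / s i) ^ 3" for i
  proof -
    have "card (B i) \<le> card (L i \<times> L i \<times> L i)" unfolding B_def by (rule card_image_le) (use L(1) in simp)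
    also have "\<dots> = card (L i) ^ 3" by (simp add: card_cartesian_product power3_eq_cube)
    finally have "real (card (B i)) \<le> real (card (L i)) ^ 3" by (metis of_nat_le_iff of_nat_power)
    also have "\<dots> \<le> (5 / s i) ^ 3" by (intro power_mono L) auto
    finally show ?thesis .
  qed
  have cover_ball: "cball (0 :: (real ^ 'n) \<times> (real ^ 'n)) 1 \<subseteq> (\<Union>i. \<Union>z\<in>B i. cball z (9 * s i))"
  proof
    fix z :: "(real ^ 'n) \<times> (real ^ 'n)" assume z: "z \<in> cball 0 1"
    obtain a b where ab: "z = (a, b)" by (cases z)
    have "norm a \<le> 1" "norm b \<le> 1" using z norm_fst_le[of a b] norm_snd_le[of b a] by (auto simp: ab)
    then obtain \<alpha> \<beta> \<gamma> u v where uv: "(u, v) \<in> triangle_manifold" and le: "\<bar>\<alpha>\<bar> \<le> 2" "\<bar>\<beta>\<bar> \<le> 2" "\<bar>\<gamma>\<bar> \<le> 2"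
      and eq: "a = \<alpha> *\<^sub>R u" "b = \<beta> *\<^sub>R u + \<gamma> *\<^sub>R v"
      using triangle_parametrization_covers[OF _ _ d] by metis
    obtain i where i: "(u, v) \<in> U i" using uv cover by blast
    then have mi: "m i \<in> U i" unfolding m_def by (rule someI)
    obtain \<alpha>' \<beta>' \<gamma>' where L': "\<alpha>' \<in> L i" "\<beta>' \<in> L i" "\<gamma>' \<in> L i"
      and le': "\<bar>\<alpha> - \<alpha>'\<bar> \<le> s i" "\<bar>\<beta> - \<beta>'\<bar> \<le> s i" "\<bar>\<gamma> - \<gamma>'\<bar> \<le> s i"
      using L(4)[OF le(1)] L(4)[OF le(2)] L(4)[OF le(3)] by metis
    have le2: "\<bar>t\<bar> \<le> 2" if "t \<in> L i" for t using subsetD[OF L(3) that] by (auto simp: abs_le_iff)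
    obtain u' v' where muv: "m i = (u', v')" by (cases "m i")
    have "dist (\<alpha> *\<^sub>R u, \<beta> *\<^sub>R u + \<gamma> *\<^sub>R v) (\<alpha>' *\<^sub>R u', \<beta>' *\<^sub>R u' + \<gamma>' *\<^sub>R v') \<le> 9 * s i"
    proof (rule triangle_parametrization_lipschitz)
      show "norm u \<le> 1" "norm v \<le> 1" using uv by (auto simp: triangle_manifold_def)
      show "dist (u, v) (u', v') \<le> s i" using diam[OF i mi] by (simp add: muv)
    qed (use le' le2 L' in auto)
    then have "z \<in> cball (\<Phi> \<alpha>' \<beta>' \<gamma>' (m i)) (9 * s i)"
      by (simp add: ab eq \<Phi>_def muv dist_commute)
    moreover have "\<Phi> \<alpha>' \<beta>' \<gamma>' (m i) \<in> B i"
      unfolding B_def using L' by (intro image_eqI[where x="(\<alpha>', \<beta>', \<gamma>')"]) auto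
    ultimately show "z \<in> (\<Union>i. \<Union>z\<in>B i. cball z (9 * s i))" by blast
  qed
  have ms: "(\<Union>z\<in>B i. cball z (9 * s i)) \<in> sets lborel" for i
    by (intro sets.finite_UN finB) auto
  have "emeasure lborel (cball (0 :: (real ^ 'n) \<times> (real ^ 'n)) 1)
      \<le> emeasure lborel (\<Union>i. \<Union>z\<in>B i. cball z (9 * s i))"
    by (intro emeasure_mono cover_ball sets.countable_UN image_subsetI ms)
  also have "\<dots> \<le> (\<Sum>i. emeasure lborel (\<Union>z\<in>B i. cball z (9 * s i)))"
    by (intro emeasure_subadditive_countably image_subsetI ms)
  also have "\<dots> \<le> (\<Sum>i. ennreal (125 * 9 ^ (2 * CARD('n))) * ennreal (s i ^ (2 * CARD('n) - 3)) * ennreal ?w)"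
  proof (intro suminf_le)
    fix i
    have si: "0 < s i" by (rule s)
    have "emeasure lborel (\<Union>z\<in>B i. cball z (9 * s i)) \<le> (\<Sum>z\<in>B i. emeasure lborel (cball z (9 * s i)))"
      by (intro emeasure_subadditive_finite finB) auto
    also have "\<dots> = ennreal (real (card (B i)) * (?w * (9 * s i) ^ ?D))"
      using si by (simp add: emeasure_cball ennreal_mult ennreal_of_nat_eq_real_of_nat)
    also have "\<dots> \<le> ennreal ((5 / s i) ^ 3 * (?w * (9 * s i) ^ ?D))"
      using si by (intro ennreal_leI mult_right_mono cardB) auto
    also have "(5 / s i) ^ 3 * (?w * (9 * s i) ^ ?D) = 125 * 9 ^ (2 * CARD('n)) * s i ^ (2 * CARD('n) - 3) * ?w"
    proof -
      have "2 * CARD('n) = 3 + (2 * CARD('n) - 3)" using d by simp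
      then have pw: "s i ^ (2 * CARD('n)) = s i ^ 3 * s i ^ (2 * CARD('n) - 3)" by (metis power_add)
      have D: "?D = 2 * CARD('n)" by simp
      show ?thesis using si unfolding D power_mult_distrib pw by (simp add: power_divide)
    qed
    also have "ennreal \<dots> = ennreal (125 * 9 ^ (2 * CARD('n))) * ennreal (s i ^ (2 * CARD('n) - 3)) * ennreal ?w"
      using si by (simp only: ennreal_mult[symmetric] zero_le_power less_imp_le mult_nonneg_nonneg zero_le_numeral unit_ball_vol_nonneg)
    finally show "emeasure lborel (\<Union>z\<in>B i. cball z (9 * s i)) \<le> \<dots>" .
  qed auto
  also have "\<dots> = ennreal (125 * 9 ^ (2 * CARD('n))) * (\<Sum>i. ennreal (s i ^ (2 * CARD('n) - 3))) * ennreal ?w"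
    by (simp only: ennreal_suminf_multc ennreal_suminf_cmult)
  finally have final: "1 * ennreal ?w \<le> ennreal (125 * 9 ^ (2 * CARD('n))) * (\<Sum>i. ennreal (s i ^ (2 * CARD('n) - 3))) * ennreal ?w"
    by (simp add: emeasure_cball)
  have w_neq: "?w \<noteq> 0"
    using unit_ball_vol_pos[of ?D] by (metis less_irrefl of_nat_0_le_iff)
  show ?thesis
    using final by (subst (asm) mult.commute, subst (asm) (2) mult.commute, subst (asm) ennreal_mult_le_mult_iff)
      (use w_neq in auto)
qed

text \<open>Otherwise some cover has total weight below \<epsilon>. Sizes adjusted to be positive
  cost at most another \<epsilon>, and \<epsilon> is chosen so that
  \<open>K * (2 * \<epsilon>) = 1/2\<close> contradicts the volume bound.\<close>

lemma hausdorff_outer_triangle_manifold_pos: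
  assumes d: "CARD('n) \<ge> 2"
  shows "0 < hausdorff_outer (2 * CARD('n) - 3) (triangle_manifold :: ((real ^ 'n) \<times> (real ^ 'n)) set)"
proof (rule ccontr)
  let ?k = "2 * CARD('n) - 3" and ?M = "triangle_manifold :: ((real ^ 'n) \<times> (real ^ 'n)) set"
  define K :: real where "K = 125 * 9 ^ (2 * CARD('n))"
  have K: "1 \<le> K" unfolding K_def using one_le_power[of "9::real" "2 * CARD('n)"] by linarith
  define \<epsilon> where "\<epsilon> = 1 / (4 * K)"
  have \<epsilon>: "0 < \<epsilon>" "\<epsilon> \<le> 1" "K * (2 * \<epsilon>) = 1 / 2" using K by (auto simp: \<epsilon>_def field_simps)
  assume "\<not> 0 < hausdorff_outer ?k ?M"
  then have "hausdorff_content ?k 1 ?M < ennreal \<epsilon>"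
    using hausdorff_content_le_outer[of 1 ?k ?M] \<epsilon>(1) by (simp add: ennreal_less_zero_iff)
  then obtain U where U: "U \<in> fine_covers 1 ?M" and sum: "(\<Sum>i. diam_weight ?k (U i)) < ennreal \<epsilon>"
    unfolding hausdorff_content_def INF_less_iff by blast
  have bU: "bounded (U i)" "diameter (U i) \<le> 1" and cover: "?M \<subseteq> (\<Union>i. U i)" for i
    using U by (auto simp: fine_covers_def)
  \<comment> \<open>Sets of diameter 0 are given positive sizes of total \<epsilon>. As
    \<open>?k\<close> is positive and these sizes are at most 1, their powers are no larger.\<close>
  define s where "s = (\<lambda>i. if diameter (U i) = 0 then \<epsilon> * (1/2) ^ Suc i else diameter (U i))"
  have small: "0 < \<epsilon> * (1/2) ^ Suc i" "\<epsilon> * (1/2) ^ Suc i \<le> 1" for i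
  proof -
    show "0 < \<epsilon> * (1/2) ^ Suc i" using \<epsilon> by simp
    show "\<epsilon> * (1/2) ^ Suc i \<le> 1" using \<epsilon> by (intro mult_le_one power_le_one) auto
  qed
  have s: "0 < s i" "s i \<le> 1" for i
    using small[of i] diameter_ge_0[OF bU(1), of i] bU(2)[of i] by (auto simp: s_def)
  have dist: "dist x y \<le> s i" if "x \<in> U i" "y \<in> U i" for i x y
    using diameter_bounded_bound[OF bU(1) that] small(1)[of i] unfolding s_def by (cases "diameter (U i) = 0") auto
  have k: "?k \<noteq> 0" using d by simp
  have weight: "ennreal (s i ^ ?k) \<le> diam_weight ?k (U i) + ennreal (\<epsilon> * (1/2) ^ Suc i)" for i
  proof (cases "diameter (U i) = 0")
    case True
    then have "s i ^ ?k \<le> s i ^ 1" using s[of i] k by (intro power_decreasing) auto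
    then show ?thesis using True by (intro add_increasing ennreal_leI) (auto simp: s_def)
  next
    case False
    then show ?thesis by (auto simp: s_def diam_weight_def diameter_def intro: add_increasing2)
  qed
  have "(\<Sum>i. ennreal (s i ^ ?k)) \<le> (\<Sum>i. diam_weight ?k (U i) + ennreal (\<epsilon> * (1/2) ^ Suc i))"
    by (intro suminf_le weight) auto
  also have "\<dots> = (\<Sum>i. diam_weight ?k (U i)) + (\<Sum>i. ennreal (\<epsilon> * (1/2) ^ Suc i))"
    by (rule suminf_add[symmetric]) auto
  also have "(\<Sum>i. ennreal (\<epsilon> * (1/2) ^ Suc i)) = ennreal (\<epsilon> * 1)"
    using \<epsilon> by (intro suminf_ennreal_eq sums_mult power_half_series) auto
  also have "(\<Sum>i. diam_weight ?k (U i)) + ennreal (\<epsilon> * 1) \<le> ennreal \<epsilon> + ennreal \<epsilon>"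
    using sum by (intro add_mono) auto
  also have "\<dots> = ennreal (2 * \<epsilon>)" using \<epsilon> by (simp add: ennreal_plus[symmetric] del: ennreal_plus)
  finally have "(\<Sum>i. ennreal (s i ^ ?k)) \<le> ennreal (2 * \<epsilon>)" .
  then have "1 \<le> ennreal K * ennreal (2 * \<epsilon>)"
    using triangle_manifold_cover_lower_bound[OF cover dist s d] mult_left_mono[of _ "ennreal (2 * \<epsilon>)" "ennreal K"]
    unfolding K_def by (meson order_trans zero_le)
  also have "\<dots> = ennreal (1 / 2)" using \<epsilon> K by (simp only: ennreal_mult[symmetric])
  also have "\<dots> < ennreal 1" by (rule ennreal_lessI) auto
  finally show False by simp
qed


section \<open>The normalized surface measure: total mass, symmetries and caps\<close>

lemma sets_triangle_measure [simp, measurable_cong]: "sets triangle_measure = sets borel"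
  by (simp add: triangle_measure_def)

lemma space_triangle_measure [simp]: "space triangle_measure = UNIV"
  by (simp add: triangle_measure_def)

lemma emeasure_triangle_measure:
  fixes A :: "((real ^ 'n) \<times> (real ^ 'n)) set"
  assumes "A \<in> sets borel"
  shows "emeasure triangle_measure A = hausdorff_outer (2 * CARD('n) - 3) (triangle_manifold \<inter> A) /
    hausdorff_outer (2 * CARD('n) - 3) (triangle_manifold :: ((real ^ 'n) \<times> (real ^ 'n)) set)"
proof -
  have M: "(triangle_manifold :: ((real ^ 'n) \<times> (real ^ 'n)) set) \<in> sets borel"
    by (rule borel_closed[OF closed_triangle_manifold])
  then show ?thesis
    unfolding triangle_measure_def using assms
    by (subst emeasure_uniform_measure) (auto simp: emeasure_hausdorff_measure)
qed

text \<open>In \<open>ennreal\<close> the quotient of a number by itself is 1 only if it is neither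
  0 nor infinite, so both mass bounds are used.\<close>

lemma prob_space_triangle_measure:
  assumes d: "CARD('n) \<ge> 2"
  shows "prob_space (triangle_measure :: ((real ^ 'n) \<times> (real ^ 'n)) measure)"
proof (rule prob_spaceI)
  show "emeasure triangle_measure (space triangle_measure :: ((real ^ 'n) \<times> (real ^ 'n)) set) = 1"
    using hausdorff_outer_triangle_manifold_finite[OF d] hausdorff_outer_triangle_manifold_pos[OF d]
    by (simp add: emeasure_triangle_measure ennreal_divide_self less_top)
qed

lemma emeasure_triangle_measure_image_le:
  fixes A B :: "((real ^ 'n) \<times> (real ^ 'n)) set"
  assumes "A \<in> sets borel" "B \<in> sets borel" and f: "\<And>x y. dist (f x) (f y) \<le> dist x y"
    and "triangle_manifold \<inter> B \<subseteq> f ` (triangle_manifold \<inter> A)"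
  shows "emeasure triangle_measure B \<le> emeasure triangle_measure A"
proof -
  have "hausdorff_outer k (triangle_manifold \<inter> B) \<le> hausdorff_outer k (triangle_manifold \<inter> A)" for k
    using hausdorff_outer_mono[OF assms(4)] hausdorff_outer_image_le[OF f] by (rule order_trans)
  then show ?thesis
    unfolding emeasure_triangle_measure[OF assms(1)] emeasure_triangle_measure[OF assms(2)]
    by (rule divide_right_mono_ennreal)
qed

text \<open>A rotation taking \<open>e\<close> to \<open>p\<close>, applied to both components,
  preserves the manifold and maps the part of it over the cap at \<open>e\<close> onto the part over
  the cap at \<open>p\<close>.\<close>

lemma triangle_measure_rotate_cap:
  fixes p e :: "real ^ 'n"
  assumes "norm p = 1" "norm e = 1"
  shows "emeasure triangle_measure (cball p s \<times> UNIV :: ((real ^ 'n) \<times> (real ^ 'n)) set)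
    \<le> emeasure triangle_measure (cball e s \<times> UNIV)"
proof -
  obtain T where T: "orthogonal_transformation T" "T e = p"
    using orthogonal_transformation_exists[of e p] assms by auto
  then have lin: "linear T" and iso: "\<And>x. norm (T x) = norm x"
    by (auto simp: orthogonal_transformation)
  have diff: "T x - T y = T (x - y)" for x y using lin by (simp add: linear_diff)
  have "dist (map_prod T T x) (map_prod T T y) \<le> dist x y" for x y :: "(real ^ 'n) \<times> (real ^ 'n)"
    by (cases x; cases y) (simp add: dist_norm diff norm_Pair iso)
  moreover have "triangle_manifold \<inter> (cball p s \<times> UNIV) \<subseteq> map_prod T T ` (triangle_manifold \<inter> (cball e s \<times> UNIV))"
  proof clarify
    fix u v assume uv: "(u, v) \<in> triangle_manifold" "u \<in> cball p s"
    obtain u' v' where eq: "u = T u'" "v = T v'"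
      using orthogonal_transformation_surj[OF T(1)] by (meson surjD)
    then have "(u', v') \<in> triangle_manifold \<inter> (cball e s \<times> UNIV)"
      using uv by (auto simp: triangle_manifold_def diff iso dist_norm T(2)[symmetric])
    then show "(u, v) \<in> map_prod T T ` (triangle_manifold \<inter> (cball e s \<times> UNIV))"
      unfolding eq by (intro image_eqI[where x="(u', v')"]) auto
  qed
  ultimately show ?thesis
    by (intro emeasure_triangle_measure_image_le[where f="map_prod T T"]) (auto simp: borel_prod[symmetric])
qed

text \<open>Rotations permute the caps of a given radius, and \<open>O(s\<^bsup>1-d\<^esup>)\<close> of them cover the sphere, so none
  of them can have small measure.\<close>

lemma triangle_measure_cap_fst:
  fixes e :: "real ^ 'n"
  assumes e: "norm e = 1" and s: "0 < s" "s \<le> 1" and d: "CARD('n) \<ge> 2"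
  shows "s ^ (CARD('n) - 1) / 5 ^ CARD('n) \<le> measure triangle_measure (cball e s \<times> (UNIV :: (real ^ 'n) set))"
proof -
  interpret prob_space "triangle_measure :: ((real ^ 'n) \<times> (real ^ 'n)) measure"
    by (rule prob_space_triangle_measure[OF d])
  obtain P where P: "finite P" "P \<subseteq> sphere (0 :: real ^ 'n) 1" "sphere 0 1 \<subseteq> (\<Union>x\<in>P. cball x s)"
    "real (card P) * s ^ (DIM(real ^ 'n) - 1) \<le> 5 ^ DIM(real ^ 'n)"
    using sphere_net[OF s] by metis
  let ?C = "\<lambda>x. cball x s \<times> (UNIV :: (real ^ 'n) set)"
  have meas: "?C x \<in> sets triangle_measure" for x
    by (simp add: borel_prod[symmetric])
  have caps: "measure triangle_measure (?C x) \<le> measure triangle_measure (?C e)" if "x \<in> P" for x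
    using triangle_measure_rotate_cap[of x e s] that P(2) e by (auto simp: emeasure_eq_measure)
  have "triangle_manifold \<inter> (\<Union>x\<in>P. ?C x) = (triangle_manifold :: ((real ^ 'n) \<times> (real ^ 'n)) set)"
    using P(3) by (fastforce simp: triangle_manifold_def)
  moreover have "(\<Union>x\<in>P. ?C x) \<in> sets borel"
    using meas P(1) by (intro sets.finite_UN) auto
  ultimately have "emeasure triangle_measure (\<Union>x\<in>P. ?C x) = emeasure triangle_measure (UNIV :: ((real ^ 'n) \<times> (real ^ 'n)) set)"
    by (simp add: emeasure_triangle_measure)
  then have "1 = measure triangle_measure (\<Union>x\<in>P. ?C x)"
    using prob_space by (simp add: measure_def)
  also have "\<dots> \<le> (\<Sum>x\<in>P. measure triangle_measure (?C x))"
    using P(1) meas by (intro finite_measure_subadditive_finite) auto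
  also have "\<dots> \<le> (\<Sum>x\<in>P. measure triangle_measure (?C e))"
    by (intro sum_mono caps)
  also have "\<dots> = real (card P) * measure triangle_measure (?C e)" by simp
  finally have "1 \<le> real (card P) * measure triangle_measure (?C e)" .
  then have "s ^ (CARD('n) - 1) * 1 \<le> s ^ (CARD('n) - 1) * (real (card P) * measure triangle_measure (?C e))"
    using s by (intro mult_left_mono) auto
  also have "\<dots> = (real (card P) * s ^ (CARD('n) - 1)) * measure triangle_measure (?C e)" by simp
  also have "\<dots> \<le> 5 ^ CARD('n) * measure triangle_measure (?C e)"
    using P(4) by (intro mult_right_mono) auto
  finally show ?thesis by (simp add: field_simps)
qed

text \<open>Swapping the two components is an isometry preserving the manifold, which reduces this
  to the first component.\<close>

lemma triangle_measure_cap_snd: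
  fixes e :: "real ^ 'n"
  assumes e: "norm e = 1" and s: "0 < s" "s \<le> 1" and d: "CARD('n) \<ge> 2"
  shows "s ^ (CARD('n) - 1) / 5 ^ CARD('n) \<le> measure triangle_measure ((UNIV :: (real ^ 'n) set) \<times> cball e s)"
proof -
  interpret prob_space "triangle_measure :: ((real ^ 'n) \<times> (real ^ 'n)) measure"
    by (rule prob_space_triangle_measure[OF d])
  have "emeasure triangle_measure (cball e s \<times> (UNIV :: (real ^ 'n) set))
      \<le> emeasure triangle_measure ((UNIV :: (real ^ 'n) set) \<times> cball e s)"
  proof (rule emeasure_triangle_measure_image_le[where f=prod.swap])
    show "triangle_manifold \<inter> (cball e s \<times> UNIV) \<subseteq> prod.swap ` (triangle_manifold \<inter> (UNIV \<times> cball e s))"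
      by (force simp: triangle_manifold_def norm_minus_commute image_iff)
  qed (auto simp: borel_prod[symmetric] dist_prod_def add.commute)
  then show ?thesis
    using triangle_measure_cap_fst[OF e s d] by (simp add: emeasure_eq_measure)
qed


subsection \<open>Gaussians are Schwartz functions\<close>

text \<open>Sums of real polynomials times Gaussians. The closure rules are those that the product
  rule needs, so all iterated partial derivatives stay in the class and no formula for them is
  required.\<close>

inductive_set gaussian_span :: "(real ^ 'n::finite \<Rightarrow> complex) set" where
  gaussian: "0 < c \<Longrightarrow> (\<lambda>x. complex_of_real (exp (- c * (x \<bullet> x)))) \<in> gaussian_span"
| coordinate: "f \<in> gaussian_span \<Longrightarrow> (\<lambda>x. complex_of_real (x $ i) * f x) \<in> gaussian_span"
| scale: "f \<in> gaussian_span \<Longrightarrow> (\<lambda>x. complex_of_real c * f x) \<in> gaussian_span"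
| add: "f \<in> gaussian_span \<Longrightarrow> g \<in> gaussian_span \<Longrightarrow> (\<lambda>x. f x + g x) \<in> gaussian_span"

text \<open>A total derivative is provided, not just partial ones, because \<open>schwartz\<close>
  asks for differentiability of every iterated partial derivative.\<close>

lemma gaussian_span_has_derivative:
  fixes f :: "real ^ 'n \<Rightarrow> complex"
  shows "f \<in> gaussian_span \<Longrightarrow>
    \<exists>D. (\<forall>x. (f has_derivative D x) (at x)) \<and> (\<forall>i. (\<lambda>x. D x (axis i 1)) \<in> gaussian_span)"
proof (induction rule: gaussian_span.induct)
  case (gaussian c)
  let ?D = "\<lambda>x h. complex_of_real (exp (- c * (x \<bullet> x)) * (- c * (x \<bullet> h + h \<bullet> x)))"
  have "((\<lambda>x. complex_of_real (exp (- c * (x \<bullet> x)))) has_derivative ?D x) (at x)" for x :: "real ^ 'n"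
    by (auto intro!: derivative_eq_intros simp: algebra_simps)
  moreover have "(\<lambda>x. ?D x (axis i 1)) \<in> gaussian_span" for i :: 'n
  proof -
    have eq: "(\<lambda>x. ?D x (axis i 1)) =
        (\<lambda>x. complex_of_real (- 2 * c) * (complex_of_real (x $ i) * complex_of_real (exp (- c * (x \<bullet> x)))))"
      by (auto simp: fun_eq_iff inner_axis inner_axis' algebra_simps)
    show ?thesis
      unfolding eq by (intro gaussian_span.scale gaussian_span.coordinate gaussian_span.gaussian gaussian)
  qed
  ultimately show ?case by (intro exI[of _ ?D]) blast
next
  case (coordinate f i)
  then obtain D where D: "\<And>x. (f has_derivative D x) (at x)" "\<And>i. (\<lambda>x. D x (axis i 1)) \<in> gaussian_span"
    by blast
  let ?D = "\<lambda>x h. complex_of_real (x $ i) * D x h + complex_of_real (h $ i) * f x"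
  have "((\<lambda>x. complex_of_real (x $ i) * f x) has_derivative ?D x) (at x)" for x
    by (intro has_derivative_mult has_derivative_of_real D bounded_linear.has_derivative[OF bounded_linear_vec_nth]
        has_derivative_ident)
  moreover have "(\<lambda>x. ?D x (axis j 1)) \<in> gaussian_span" for j
    by (intro gaussian_span.add gaussian_span.scale gaussian_span.coordinate D coordinate)
  ultimately show ?case by (intro exI[of _ ?D]) blast
next
  case (scale f c)
  then obtain D where D: "\<And>x. (f has_derivative D x) (at x)" "\<And>i. (\<lambda>x. D x (axis i 1)) \<in> gaussian_span"
    by blast
  have "((\<lambda>x. complex_of_real c * f x) has_derivative (\<lambda>h. complex_of_real c * D x h)) (at x)" for x
    by (intro has_derivative_mult_right D)
  moreover have "(\<lambda>x. complex_of_real c * D x (axis j 1)) \<in> gaussian_span" for j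
    by (intro gaussian_span.scale D)
  ultimately show ?case by (intro exI[of _ "\<lambda>x h. complex_of_real c * D x h"]) blast
next
  case (add f g)
  then obtain D E where D: "\<And>x. (f has_derivative D x) (at x)" "\<And>i. (\<lambda>x. D x (axis i 1)) \<in> gaussian_span"
    and E: "\<And>x. (g has_derivative E x) (at x)" "\<And>i. (\<lambda>x. E x (axis i 1)) \<in> gaussian_span"
    by blast
  have "((\<lambda>x. f x + g x) has_derivative (\<lambda>h. D x h + E x h)) (at x)" for x
    by (intro has_derivative_add D E)
  moreover have "(\<lambda>x. D x (axis j 1) + E x (axis j 1)) \<in> gaussian_span" for j
    by (intro gaussian_span.add D E)
  ultimately show ?case by (intro exI[of _ "\<lambda>x h. D x h + E x h"]) blast
qed

lemma gaussian_span_iter_partial: "f \<in> gaussian_span \<Longrightarrow> iter_partial is f \<in> gaussian_span"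
proof (induction "is")
  case (Cons i "is")
  then obtain D where D: "\<And>x. (iter_partial is f has_derivative D x) (at x)"
    "\<And>i. (\<lambda>x. D x (axis i 1)) \<in> gaussian_span"
    using gaussian_span_has_derivative by blast
  have "iter_partial (i # is) f = (\<lambda>x. D x (axis i 1))"
    by (simp add: frechet_derivative_at[OF D(1), symmetric])
  then show ?case using D(2) by simp
qed simp

text \<open>From \<open>(1 + t/k)^k \<le> exp t\<close> with \<open>t = c * s^2\<close> one gets
  \<open>s^(2k) \<le> (k/c)^k * exp (c * s^2)\<close>; then
  \<open>s^k \<le> 1 + s^(2k)\<close>.\<close>

lemma power_times_gaussian_le:
  fixes s c :: real
  assumes "0 \<le> s" "0 < c"
  shows "s ^ k * exp (- c * s\<^sup>2) \<le> 1 + (real k / c) ^ k"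
proof (cases "k = 0")
  case False
  have "(c * s\<^sup>2 / real k) ^ k \<le> (1 + c * s\<^sup>2 / real k) ^ k"
    using assms by (intro power_mono) auto
  also have "\<dots> \<le> exp (c * s\<^sup>2)"
    using False assms by (intro exp_ge_one_plus_x_over_n_power_n) (auto intro: order_trans[of _ 0])
  finally have "(real k / c) ^ k * (c * s\<^sup>2 / real k) ^ k \<le> (real k / c) ^ k * exp (c * s\<^sup>2)"
    using assms by (intro mult_left_mono) auto
  moreover have "(real k / c) ^ k * (c * s\<^sup>2 / real k) ^ k = (s\<^sup>2) ^ k"
    using False assms by (simp add: power_mult_distrib[symmetric])
  ultimately have *: "(s\<^sup>2) ^ k \<le> (real k / c) ^ k * exp (c * s\<^sup>2)" by simp
  have "s ^ k \<le> 1 + (s\<^sup>2) ^ k"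
  proof (cases "s \<le> 1")
    case True
    then have "s ^ k \<le> 1" using assms by (simp add: power_le_one)
    then show ?thesis by (simp add: add_increasing2)
  next
    case False
    then have "s ^ k \<le> (s\<^sup>2) ^ k" using self_le_power[of s 2] by (intro power_mono) auto
    then show ?thesis by simp
  qed
  also have "\<dots> \<le> exp (c * s\<^sup>2) + (real k / c) ^ k * exp (c * s\<^sup>2)"
    using * assms by (intro add_mono) auto
  finally have "s ^ k * exp (- (c * s\<^sup>2)) \<le> (exp (c * s\<^sup>2) + (real k / c) ^ k * exp (c * s\<^sup>2)) * exp (- (c * s\<^sup>2))"
    by (intro mult_right_mono) auto
  also have "\<dots> = 1 + (real k / c) ^ k"
    by (simp add: distrib_right mult.assoc exp_add[symmetric])
  finally show ?thesis by simp
next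
  case True
  have "exp (- (c * s\<^sup>2)) \<le> 1" using assms by simp
  also have "\<dots> \<le> 2" by simp
  finally show ?thesis using True by simp
qed

text \<open>The induction varies \<open>k\<close>, since a coordinate factor costs one power of the
  norm.\<close>

lemma gaussian_span_decay: "f \<in> gaussian_span \<Longrightarrow> \<exists>K. \<forall>x. norm x ^ k * norm (f x) \<le> K"
proof (induction arbitrary: k rule: gaussian_span.induct)
  case (gaussian c)
  then show ?case
    using power_times_gaussian_le[of _ c k] by (intro exI[of _ "1 + (real k / c) ^ k"]) (simp add: dot_square_norm)
next
  case (coordinate f i)
  then obtain K where K: "\<And>x. norm x ^ Suc k * norm (f x) \<le> K" by blast
  have "norm x ^ k * norm (complex_of_real (x $ i) * f x) \<le> K" for x
  proof -
    have "norm x ^ k * norm (complex_of_real (x $ i) * f x) = \<bar>x $ i\<bar> * (norm x ^ k * norm (f x))"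
      by (simp add: norm_mult)
    also have "\<dots> \<le> norm x * (norm x ^ k * norm (f x))"
      by (intro mult_right_mono component_le_norm_cart) auto
    finally show ?thesis using K[of x] by (simp add: mult.assoc)
  qed
  then show ?case by blast
next
  case (scale f c)
  then obtain K where K: "\<And>x. norm x ^ k * norm (f x) \<le> K" by blast
  have "norm x ^ k * norm (complex_of_real c * f x) \<le> \<bar>c\<bar> * K" for x
    using mult_left_mono[OF K[of x], of "\<bar>c\<bar>"] by (simp add: norm_mult mult.left_commute)
  then show ?case by blast
next
  case (add f g)
  then obtain K L where K: "\<And>x. norm x ^ k * norm (f x) \<le> K" and L: "\<And>x. norm x ^ k * norm (g x) \<le> L"
    by blast
  have "norm x ^ k * norm (f x + g x) \<le> K + L" for x
    using mult_left_mono[OF norm_triangle_ineq[of "f x" "g x"], of "norm x ^ k"] K[of x] L[of x]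
    by (simp add: distrib_left)
  then show ?case by blast
qed

lemma schwartz_gaussian_span:
  assumes "f \<in> gaussian_span"
  shows "schwartz f"
  unfolding schwartz_def
proof (intro conjI allI)
  fix "is" k
  note iter = gaussian_span_iter_partial[OF assms, of "is"]
  show "iter_partial is f differentiable_on UNIV"
    using gaussian_span_has_derivative[OF iter] by (auto simp: differentiable_on_def differentiable_def)
  show "bounded (range (\<lambda>x. norm x ^ k *\<^sub>R iter_partial is f x))"
    using gaussian_span_decay[OF iter, of k] by (auto simp: bounded_iff)
qed

section \<open>The test functions and their Schwartz property\<close>

definition gaussian_sum :: "nat \<Rightarrow> real ^ 'n::finite \<Rightarrow> real" where
  "gaussian_sum N x = (\<Sum>j<N. 2 ^ (j * (CARD('n) - 1)) * exp (- (4 ^ j) * (x \<bullet> x)))"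

lemma schwartz_gaussian: "schwartz (\<lambda>x. complex_of_real (exp (- (x \<bullet> x))))"
  using schwartz_gaussian_span[OF gaussian_span.gaussian[of 1]] by simp

lemma schwartz_gaussian_sum: "schwartz (\<lambda>x. complex_of_real (gaussian_sum N x))"
proof (rule schwartz_gaussian_span)
  show "(\<lambda>x :: real ^ 'n. complex_of_real (gaussian_sum N x)) \<in> gaussian_span"
  proof (induction N)
    case 0
    show ?case
      using gaussian_span.scale[OF gaussian_span.gaussian[of 1], of 0] by (simp add: gaussian_sum_def)
  next
    case (Suc N)
    have "(\<lambda>x :: real ^ 'n. complex_of_real (gaussian_sum N x) +
        complex_of_real (2 ^ (N * (CARD('n) - 1))) * complex_of_real (exp (- (4 ^ N) * (x \<bullet> x)))) \<in> gaussian_span"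
      by (intro gaussian_span.add Suc.IH gaussian_span.scale gaussian_span.gaussian) simp
    then show ?case by (simp add: gaussian_sum_def)
  qed
qed

lemma gaussian_sum_nonneg: "0 \<le> gaussian_sum N x"
  unfolding gaussian_sum_def by (intro sum_nonneg) auto

lemma continuous_on_gaussian_sum [continuous_intros]:
  "continuous_on S f \<Longrightarrow> continuous_on S (\<lambda>z. gaussian_sum N (f z))"
  unfolding gaussian_sum_def by (intro continuous_intros)

subsection \<open>Integrals of Gaussians\<close>

lemma nn_integral_lborel_scaleR:
  fixes h :: "'a::euclidean_space \<Rightarrow> ennreal"
  assumes [measurable]: "h \<in> borel_measurable borel" and c: "0 < c"
  shows "(\<integral>\<^sup>+ x. h (c *\<^sub>R x) \<partial>lborel) = ennreal (1 / c ^ DIM('a)) * (\<integral>\<^sup>+ x. h x \<partial>lborel)"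
proof -
  have "(\<integral>\<^sup>+ x. h x \<partial>lborel) = (\<integral>\<^sup>+ x. ennreal (c ^ DIM('a)) * h (c *\<^sub>R x) \<partial>lborel)"
    using c by (subst lborel_affine[of c 0]) (auto simp: nn_integral_density nn_integral_distr)
  also have "\<dots> = ennreal (c ^ DIM('a)) * (\<integral>\<^sup>+ x. h (c *\<^sub>R x) \<partial>lborel)"
    by (intro nn_integral_cmult) auto
  finally have "ennreal (1 / c ^ DIM('a)) * (\<integral>\<^sup>+ x. h x \<partial>lborel) =
      ennreal (1 / c ^ DIM('a) * c ^ DIM('a)) * (\<integral>\<^sup>+ x. h (c *\<^sub>R x) \<partial>lborel)"
    using c by (simp add: mult.assoc[symmetric] ennreal_mult[symmetric])
  also have "1 / c ^ DIM('a) * c ^ DIM('a) = 1" using c by simp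
  finally show ?thesis by simp
qed

text \<open>The integrand is a product over \<open>Basis\<close> of one-dimensional Gaussians, each
  a multiple of the standard normal density.\<close>

lemma nn_integral_gaussian_finite: "(\<integral>\<^sup>+ (x::'a::euclidean_space). ennreal (exp (- (x \<bullet> x) / 2)) \<partial>lborel) < \<infinity>"
proof -
  have one: "(\<integral>\<^sup>+ (t::real). ennreal (exp (- t\<^sup>2 / 2)) \<partial>lborel) < \<infinity>"
  proof -
    have "integrable lborel (\<lambda>t::real. sqrt (2 * pi) * std_normal_density t)"
      by (intro integrable_mult_right integrable_normal_density) simp
    then have "integrable lborel (\<lambda>t::real. exp (- t\<^sup>2 / 2))"
      by (simp add: std_normal_density_def)
    then show ?thesis by (simp add: integrable_iff_bounded)
  qed
  have "(\<integral>\<^sup>+ (x::'a). ennreal (exp (- (x \<bullet> x) / 2)) \<partial>lborel) =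
      (\<integral>\<^sup>+ (x::'a). (\<Prod>b\<in>Basis. ennreal (exp (- (x \<bullet> b)\<^sup>2 / 2))) \<partial>lborel)"
  proof (rule nn_integral_cong)
    fix x :: 'a
    have "x \<bullet> x = (\<Sum>b\<in>Basis. (x \<bullet> b)\<^sup>2)"
      by (subst euclidean_inner) (simp add: power2_eq_square)
    then have "exp (- (x \<bullet> x) / 2) = (\<Prod>b\<in>Basis. exp (- (x \<bullet> b)\<^sup>2 / 2))"
      by (simp add: exp_sum[symmetric] sum_negf sum_divide_distrib)
    then show "ennreal (exp (- (x \<bullet> x) / 2)) = (\<Prod>b\<in>Basis. ennreal (exp (- (x \<bullet> b)\<^sup>2 / 2)))"
      by (simp add: prod_ennreal)
  qed
  also have "\<dots> = (\<Prod>b\<in>(Basis::'a set). \<integral>\<^sup>+ t. ennreal (exp (- t\<^sup>2 / 2)) \<partial>lborel)"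
    by (intro nn_integral_lborel_prod) auto
  also have "\<dots> < \<infinity>"
    using one by (simp add: power_less_top_ennreal)
  finally show ?thesis .
qed

text \<open>An inequality in place of the exact value allows \<open>c = 2^j\<close> both for
  \<open>a = 4^j\<close> and for \<open>a = 4^j / 2\<close>, without square roots.\<close>

lemma nn_integral_gaussian_le:
  assumes "c\<^sup>2 / 2 \<le> a" "0 < c"
  shows "(\<integral>\<^sup>+ (x::'a::euclidean_space). ennreal (exp (- a * (x \<bullet> x))) \<partial>lborel)
    \<le> ennreal (1 / c ^ DIM('a)) * (\<integral>\<^sup>+ (x::'a). ennreal (exp (- (x \<bullet> x) / 2)) \<partial>lborel)"
proof -
  have "(\<integral>\<^sup>+ (x::'a). ennreal (exp (- a * (x \<bullet> x))) \<partial>lborel)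
      \<le> (\<integral>\<^sup>+ (x::'a). ennreal (exp (- ((c *\<^sub>R x) \<bullet> (c *\<^sub>R x)) / 2)) \<partial>lborel)"
  proof (intro nn_integral_mono ennreal_leI)
    fix x :: 'a
    show "exp (- a * (x \<bullet> x)) \<le> exp (- ((c *\<^sub>R x) \<bullet> (c *\<^sub>R x)) / 2)"
      using mult_right_mono[OF assms(1), of "x \<bullet> x"] by (simp add: power2_eq_square)
  qed
  also have "\<dots> = ennreal (1 / c ^ DIM('a)) * (\<integral>\<^sup>+ (x::'a). ennreal (exp (- (x \<bullet> x) / 2)) \<partial>lborel)"
    by (rule nn_integral_lborel_scaleR) (use assms in auto)
  finally show ?thesis .
qed

text \<open>With \<open>S\<close> the whole sum, \<open>S powr s\<close> is the sum of
  \<open>a i * S powr (s - 1)\<close>, and the exponent \<open>s - 1 \<le> 0\<close> allows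
  replacing \<open>S\<close> by the smaller \<open>a i\<close>.\<close>

lemma sum_powr_le:
  fixes a :: "'b \<Rightarrow> real"
  assumes "finite A" "\<And>i. i \<in> A \<Longrightarrow> 0 \<le> a i" "0 < s" "s \<le> 1"
  shows "(\<Sum>i\<in>A. a i) powr s \<le> (\<Sum>i\<in>A. a i powr s)"
proof (cases "(\<Sum>i\<in>A. a i) = 0")
  case False
  define S where "S = (\<Sum>i\<in>A. a i)"
  have S: "0 < S" using False assms sum_nonneg[of A a] by (simp add: S_def)
  have le: "a i \<le> S" if "i \<in> A" for i unfolding S_def using assms that by (intro member_le_sum) auto
  have "S powr s = S * S powr (s - 1)" using S by (simp add: powr_mult_base)
  also have "\<dots> = (\<Sum>i\<in>A. a i * S powr (s - 1))" by (simp add: S_def sum_distrib_right)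
  also have "\<dots> \<le> (\<Sum>i\<in>A. a i powr s)"
  proof (rule sum_mono)
    fix i assume i: "i \<in> A"
    show "a i * S powr (s - 1) \<le> a i powr s"
    proof (cases "a i = 0")
      case False
      then have ai: "0 < a i" using assms(2)[OF i] by simp
      have "a i * S powr (s - 1) \<le> a i * a i powr (s - 1)"
        using ai le[OF i] assms by (intro mult_left_mono powr_mono2') auto
      also have "\<dots> = a i powr s" using ai by (simp add: powr_mult_base)
      finally show ?thesis .
    qed simp
  qed
  finally show ?thesis by (simp add: S_def)
qed (simp add: sum_nonneg)

text \<open>Each new index adds a row and a column, both at most 1 by the geometric series, and a
  diagonal entry 1. The exponent is |j - k|, written so as to avoid truncated subtraction.\<close>

lemma sum_half_power_dist_le:
  "(\<Sum>j<N. \<Sum>k<N. (1/2::real) ^ (max j k - min j k)) \<le> 3 * real N"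
proof (induction N)
  case (Suc N)
  have row: "(\<Sum>j<N. (1/2::real) ^ (N - j)) \<le> 1"
  proof -
    have "(\<Sum>j<N. (1/2::real) ^ (N - j)) = 1 - (1/2) ^ N"
    proof (induction N)
      case (Suc N)
      have "(\<Sum>j<Suc N. (1/2::real) ^ (Suc N - j)) = (\<Sum>j<N. (1/2) * (1/2) ^ (N - j)) + 1/2"
        by (simp add: Suc_diff_le)
      also have "\<dots> = (1/2) * (1 - (1/2) ^ N) + 1/2" by (simp only: sum_distrib_left[symmetric] Suc.IH)
      finally show ?case by simp
    qed simp
    then show ?thesis by simp
  qed
  have "(\<Sum>j<Suc N. \<Sum>k<Suc N. (1/2::real) ^ (max j k - min j k)) =
      (\<Sum>j<N. \<Sum>k<N. (1/2::real) ^ (max j k - min j k)) +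
      (\<Sum>j<N. (1/2) ^ (max j N - min j N)) + (\<Sum>k<N. (1/2) ^ (max N k - min N k)) + 1"
    by (simp add: sum.distrib)
  also have "(\<Sum>j<N. (1/2::real) ^ (max j N - min j N)) = (\<Sum>j<N. (1/2) ^ (N - j))"
    by (intro sum.cong) (auto simp: max_def min_def)
  also have "(\<Sum>k<N. (1/2::real) ^ (max N k - min N k)) = (\<Sum>j<N. (1/2) ^ (N - j))"
    by (intro sum.cong) (auto simp: max_def min_def)
  finally show ?case using row Suc.IH by simp
qed simp


subsection \<open>Powers of extended nonnegative reals and Lebesgue norms\<close>

lemma ennreal_powr_ennreal: "0 \<le> x \<Longrightarrow> ennreal_powr (ennreal x) a = ennreal (x powr a)"
  by (simp add: ennreal_powr_def)

lemma ennreal_powr_mono: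
  assumes "x \<le> y" "0 \<le> a"
  shows "ennreal_powr x a \<le> ennreal_powr y a"
proof (cases "y = \<infinity>")
  case False
  then have "y < top" by (simp add: less_top)
  then have "x \<noteq> \<infinity>" "enn2real x \<le> enn2real y"
    using assms(1) by (auto intro: enn2real_mono)
  then show ?thesis
    using False assms(2) by (auto simp: ennreal_powr_def intro!: ennreal_leI powr_mono2)
qed (simp add: ennreal_powr_def)

lemma Lp_norm_ennreal:
  assumes "0 \<le> p"
  shows "Lp_norm (ennreal p) F = ennreal_powr (\<integral>\<^sup>+ x. ennreal_powr (F x) p \<partial>lborel) (1 / p)"
  using assms by (simp add: Lp_norm_def)

lemma Lp_norm_le:
  assumes "0 < p" "0 \<le> B" "\<And>x. 0 \<le> f x" "(\<integral>\<^sup>+ x. ennreal (f x powr p) \<partial>lborel) \<le> ennreal B"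
  shows "Lp_norm (ennreal p) (\<lambda>x. ennreal (f x)) \<le> ennreal (B powr (1 / p))"
  using ennreal_powr_mono[OF assms(4), of "1 / p"] assms(1-3)
  by (simp add: Lp_norm_ennreal ennreal_powr_ennreal)

text \<open>The power \<open>p/2 \<le> 1\<close> is subadditive, and the p-th power is the product
  of two such factors. The resulting double sum exposes the interaction of two scales, which a
  termwise triangle inequality would lose.\<close>

lemma gaussian_sum_powr_le:
  fixes x :: "real ^ 'n"
  assumes p: "1 \<le> p" "p \<le> 2"
  shows "gaussian_sum N x powr p \<le> (\<Sum>j<N. \<Sum>k<N.
    2 powr (real (j + k) * real (CARD('n) - 1) * p / 2) * exp (- (4 ^ max j k / 2) * (x \<bullet> x)))"
proof -
  define a where "a = (\<lambda>j. 2 ^ (j * (CARD('n) - 1)) * exp (- (4 ^ j) * (x \<bullet> x)))"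
  have gs: "gaussian_sum N x = (\<Sum>j<N. a j)" by (simp add: gaussian_sum_def a_def)
  have nn: "0 \<le> (\<Sum>j<N. a j powr (p / 2))" by (intro sum_nonneg) auto
  have "gaussian_sum N x powr p = gaussian_sum N x powr (p / 2) * gaussian_sum N x powr (p / 2)"
    by (simp add: powr_add[symmetric])
  also have "\<dots> \<le> (\<Sum>j<N. a j powr (p / 2)) * (\<Sum>k<N. a k powr (p / 2))"
    unfolding gs using p nn by (intro mult_mono sum_powr_le) (auto simp: a_def)
  also have "\<dots> = (\<Sum>j<N. \<Sum>k<N. a j powr (p / 2) * a k powr (p / 2))"
    by (rule sum_product)
  also have "\<dots> \<le> (\<Sum>j<N. \<Sum>k<N.
    2 powr (real (j + k) * real (CARD('n) - 1) * p / 2) * exp (- (4 ^ max j k / 2) * (x \<bullet> x)))"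
  proof (intro sum_mono)
    fix j k
    have a_powr: "a j powr (p / 2) = 2 powr (real j * real (CARD('n) - 1) * p / 2) * exp (- (4 ^ j) * (x \<bullet> x) * (p / 2))" for j
    proof -
      have "(2 ^ (j * (CARD('n) - 1)) :: real) = 2 powr (real j * real (CARD('n) - 1))"
        by (simp add: powr_realpow[symmetric])
      then show ?thesis by (simp add: a_def powr_mult powr_powr exp_powr_real)
    qed
    \<comment> \<open>Only the narrower of the two Gaussians is kept; \<open>p \<ge> 1\<close>
      leaves half of its exponent.\<close>
    have "(4::real) ^ max j k \<le> 4 ^ j + 4 ^ k" by (auto simp: max_def)
    also have "\<dots> \<le> (4 ^ j + 4 ^ k) * p" using mult_left_mono[OF p(1), of "4 ^ j + 4 ^ k"] by simp
    finally have "4 ^ max j k / 2 * (x \<bullet> x) \<le> ((4 ^ j + 4 ^ k) * p) / 2 * (x \<bullet> x)"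
      by (intro mult_right_mono divide_right_mono) auto
    then have "exp (- (4 ^ j) * (x \<bullet> x) * (p / 2)) * exp (- (4 ^ k) * (x \<bullet> x) * (p / 2)) \<le> exp (- (4 ^ max j k / 2) * (x \<bullet> x))"
      by (simp add: exp_add[symmetric] algebra_simps)
    then have "2 powr (real (j + k) * real (CARD('n) - 1) * p / 2) *
        (exp (- (4 ^ j) * (x \<bullet> x) * (p / 2)) * exp (- (4 ^ k) * (x \<bullet> x) * (p / 2)))
        \<le> 2 powr (real (j + k) * real (CARD('n) - 1) * p / 2) * exp (- (4 ^ max j k / 2) * (x \<bullet> x))"
      by (intro mult_left_mono) auto
    moreover have "2 powr (real (j + k) * real (CARD('n) - 1) * p / 2) =
        2 powr (real j * real (CARD('n) - 1) * p / 2) * 2 powr (real k * real (CARD('n) - 1) * p / 2)"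
      unfolding powr_add[symmetric] by (rule arg_cong[where f="\<lambda>t. 2 powr t"]) (simp add: field_simps)
    ultimately show "a j powr (p / 2) * a k powr (p / 2)
        \<le> 2 powr (real (j + k) * real (CARD('n) - 1) * p / 2) * exp (- (4 ^ max j k / 2) * (x \<bullet> x))"
      by (simp add: a_powr mult_ac)
  qed
  finally show ?thesis .
qed

text \<open>This is where p \<le> d/(d-1) enters: it bounds the exponent of 2 by (max+min)d/2 -
  max*d = -(max-min)d/2, and d/2 \<ge> 1 gives the decay in the distance of scales.\<close>

lemma gaussian_cross_term_coefficient:
  fixes p :: real
  assumes p: "1 \<le> p" "real (d - 1) * p \<le> real d" and d: "d \<ge> 2"
  shows "2 powr (real (j + k) * real (d - 1) * p / 2) * (1 / (2 ^ max j k) ^ d) \<le> (1 / 2) ^ (max j k - min j k)"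
proof -
  have jk: "real (j + k) = real (max j k) + real (min j k)" by (simp add: max_def min_def)
  have "real (j + k) * real (d - 1) * p / 2 \<le> real (j + k) * real d / 2"
    using mult_left_mono[OF p(2), of "real (j + k)"] by (simp add: mult.assoc)
  then have "2 powr (real (j + k) * real (d - 1) * p / 2) \<le> (2::real) powr (real (j + k) * real d / 2)"
    by (intro powr_mono) auto
  moreover have "((2::real) ^ max j k) ^ d = 2 powr (real (max j k) * real d)"
    by (simp add: power_mult[symmetric] powr_realpow[symmetric] powr_powr)
  ultimately have "2 powr (real (j + k) * real (d - 1) * p / 2) * (1 / (2 ^ max j k) ^ d)
      \<le> 2 powr (real (j + k) * real d / 2) * (1 / 2 powr (real (max j k) * real d))"
    by (simp add: divide_right_mono)
  also have "\<dots> = 2 powr (real (j + k) * real d / 2 - real (max j k) * real d)"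
    by (simp add: powr_diff)
  also have "real (j + k) * real d / 2 - real (max j k) * real d = - ((real (max j k) - real (min j k)) * (real d / 2))"
    unfolding jk by (simp add: field_simps)
  also have "2 powr (- ((real (max j k) - real (min j k)) * (real d / 2))) \<le> (2::real) powr (- ((real (max j k) - real (min j k)) * 1))"
    using d by (intro powr_mono le_imp_neg_le mult_left_mono) auto
  also have "(real (max j k) - real (min j k)) * 1 = real (max j k - min j k)"
    by (simp add: of_nat_diff)
  also have "2 powr - real (max j k - min j k) = (1 / 2 :: real) ^ (max j k - min j k)"
    by (simp only: powr_minus_divide powr_realpow power_one_over zero_less_numeral)
  finally show ?thesis .
qed

definition gaussian_mass :: "'n::finite itself \<Rightarrow> real" where
  "gaussian_mass _ = enn2real (\<integral>\<^sup>+ (x :: real ^ 'n). ennreal (exp (- (x \<bullet> x) / 2)) \<partial>lborel)"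

lemma gaussian_mass_nonneg: "0 \<le> gaussian_mass TYPE('n::finite)"
  by (simp add: gaussian_mass_def)

lemma nn_integral_gaussian_le_mass:
  assumes "c\<^sup>2 / 2 \<le> a" "0 < c"
  shows "(\<integral>\<^sup>+ (x :: real ^ 'n). ennreal (exp (- a * (x \<bullet> x))) \<partial>lborel)
    \<le> ennreal (1 / c ^ CARD('n) * gaussian_mass TYPE('n))"
proof -
  have eq: "(\<integral>\<^sup>+ (x :: real ^ 'n). ennreal (exp (- (x \<bullet> x) / 2)) \<partial>lborel) = ennreal (gaussian_mass TYPE('n))"
    using nn_integral_gaussian_finite[where 'a="real ^ 'n"] by (simp add: gaussian_mass_def less_top)
  show ?thesis
    using nn_integral_gaussian_le[OF assms, where 'a="real ^ 'n"] assms(2) gaussian_mass_nonneg[where 'n='n]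
    unfolding eq by (subst ennreal_mult) auto
qed

text \<open>Integrating the double sum leaves geometric decay off the diagonal, so the integral is
  linear in \<open>N\<close> and the norm is of order \<open>N powr (1/p)\<close>.\<close>

lemma nn_integral_gaussian_sum_powr_le:
  assumes p: "1 \<le> p" "p \<le> 2" "real (CARD('n) - 1) * p \<le> real CARD('n)" and d: "CARD('n) \<ge> 2"
  shows "(\<integral>\<^sup>+ (x :: real ^ 'n). ennreal (gaussian_sum N x powr p) \<partial>lborel) \<le> ennreal (3 * real N * gaussian_mass TYPE('n))"
proof -
  let ?G = "gaussian_mass TYPE('n)"
  define w where "w = (\<lambda>j k. 2 powr (real (j + k) * real (CARD('n) - 1) * p / 2))"
  have w: "0 \<le> w j k" for j k by (simp add: w_def)
  have cross: "(\<integral>\<^sup>+ (x :: real ^ 'n). ennreal (w j k * exp (- (4 ^ max j k / 2) * (x \<bullet> x))) \<partial>lborel)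
      \<le> ennreal ((1 / 2) ^ (max j k - min j k) * ?G)" for j k
  proof -
    have "(\<integral>\<^sup>+ (x :: real ^ 'n). ennreal (w j k * exp (- (4 ^ max j k / 2) * (x \<bullet> x))) \<partial>lborel) =
        ennreal (w j k) * (\<integral>\<^sup>+ (x :: real ^ 'n). ennreal (exp (- (4 ^ max j k / 2) * (x \<bullet> x))) \<partial>lborel)"
      using w by (simp add: ennreal_mult nn_integral_cmult)
    also have "\<dots> \<le> ennreal (w j k) * ennreal (1 / (2 ^ max j k) ^ CARD('n) * ?G)"
      by (intro mult_left_mono nn_integral_gaussian_le_mass)
        (auto simp: power2_eq_square power_mult_distrib[symmetric])
    also have "\<dots> = ennreal (w j k * (1 / (2 ^ max j k) ^ CARD('n)) * ?G)"
      using w gaussian_mass_nonneg[where 'n='n] by (simp add: ennreal_mult[symmetric])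
    also have "\<dots> \<le> ennreal ((1 / 2) ^ (max j k - min j k) * ?G)"
      unfolding w_def using gaussian_mass_nonneg[where 'n='n]
      by (intro ennreal_leI mult_right_mono gaussian_cross_term_coefficient p d)
    finally show ?thesis .
  qed
  have "(\<integral>\<^sup>+ (x :: real ^ 'n). ennreal (gaussian_sum N x powr p) \<partial>lborel)
      \<le> (\<integral>\<^sup>+ (x :: real ^ 'n). (\<Sum>j<N. \<Sum>k<N. ennreal (w j k * exp (- (4 ^ max j k / 2) * (x \<bullet> x)))) \<partial>lborel)"
  proof (intro nn_integral_mono)
    fix x :: "real ^ 'n"
    have "ennreal (gaussian_sum N x powr p) \<le> ennreal (\<Sum>j<N. \<Sum>k<N. w j k * exp (- (4 ^ max j k / 2) * (x \<bullet> x)))"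
      unfolding w_def by (intro ennreal_leI gaussian_sum_powr_le p)
    also have "\<dots> = (\<Sum>j<N. \<Sum>k<N. ennreal (w j k * exp (- (4 ^ max j k / 2) * (x \<bullet> x))))"
      using w by (simp add: sum_ennreal sum_nonneg)
    finally show "ennreal (gaussian_sum N x powr p) \<le> \<dots>" .
  qed
  also have "\<dots> = (\<Sum>j<N. \<Sum>k<N. \<integral>\<^sup>+ (x :: real ^ 'n). ennreal (w j k * exp (- (4 ^ max j k / 2) * (x \<bullet> x))) \<partial>lborel)"
    by (subst nn_integral_sum, simp, subst nn_integral_sum) auto
  also have "\<dots> \<le> (\<Sum>j<N. \<Sum>k<N. ennreal ((1 / 2) ^ (max j k - min j k) * ?G))"
    by (intro sum_mono cross)
  also have "\<dots> = ennreal ((\<Sum>j<N. \<Sum>k<N. (1 / 2) ^ (max j k - min j k)) * ?G)"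
    using gaussian_mass_nonneg[where 'n='n] by (simp add: sum_ennreal sum_nonneg sum_distrib_right)
  also have "\<dots> \<le> ennreal (3 * real N * ?G)"
    by (intro ennreal_leI mult_right_mono sum_half_power_dist_le gaussian_mass_nonneg)
  finally show ?thesis .
qed

text \<open>The term of index \<open>j\<close> has height 2^(j(d-1)) and volume scale 2^(-jd), so
  its mass is of order 2^-j.\<close>

lemma nn_integral_gaussian_sum_le:
  "(\<integral>\<^sup>+ (x :: real ^ 'n). ennreal (gaussian_sum N x) \<partial>lborel) \<le> ennreal (2 * gaussian_mass TYPE('n))"
proof -
  let ?G = "gaussian_mass TYPE('n)"
  have "(\<integral>\<^sup>+ (x :: real ^ 'n). ennreal (gaussian_sum N x) \<partial>lborel) =
      (\<Sum>j<N. \<integral>\<^sup>+ (x :: real ^ 'n). ennreal (2 ^ (j * (CARD('n) - 1))) * ennreal (exp (- (4 ^ j) * (x \<bullet> x))) \<partial>lborel)"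
    unfolding gaussian_sum_def
    by (subst nn_integral_sum[symmetric]) (auto simp: sum_ennreal[symmetric] ennreal_mult)
  also have "\<dots> \<le> (\<Sum>j<N. ennreal ((1 / 2) ^ j * ?G))"
  proof (intro sum_mono)
    fix j
    have "(\<integral>\<^sup>+ (x :: real ^ 'n). ennreal (2 ^ (j * (CARD('n) - 1))) * ennreal (exp (- (4 ^ j) * (x \<bullet> x))) \<partial>lborel)
        = ennreal (2 ^ (j * (CARD('n) - 1))) * (\<integral>\<^sup>+ (x :: real ^ 'n). ennreal (exp (- (4 ^ j) * (x \<bullet> x))) \<partial>lborel)"
      by (intro nn_integral_cmult) auto
    also have "\<dots> \<le> ennreal (2 ^ (j * (CARD('n) - 1))) * ennreal (1 / (2 ^ j) ^ CARD('n) * ?G)"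
      by (intro mult_left_mono nn_integral_gaussian_le_mass)
        (auto simp: power2_eq_square power_mult_distrib[symmetric])
    also have "\<dots> = ennreal (2 ^ (j * (CARD('n) - 1)) * (1 / (2 ^ j) ^ CARD('n)) * ?G)"
      using gaussian_mass_nonneg[where 'n='n] by (simp add: ennreal_mult[symmetric])
    also have "2 ^ (j * (CARD('n) - 1)) * (1 / (2 ^ j) ^ CARD('n)) = (1 / 2 :: real) ^ j"
    proof -
      have "CARD('n) = Suc (CARD('n) - 1)" by simp
      then have "((2::real) ^ j) ^ CARD('n) = 2 ^ j * 2 ^ (j * (CARD('n) - 1))"
        by (metis power_Suc power_mult)
      then show ?thesis by (simp add: power_one_over)
    qed
    finally show "(\<integral>\<^sup>+ (x :: real ^ 'n). ennreal (2 ^ (j * (CARD('n) - 1))) * ennreal (exp (- (4 ^ j) * (x \<bullet> x))) \<partial>lborel)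
        \<le> ennreal ((1 / 2) ^ j * ?G)" .
  qed
  also have "\<dots> = ennreal ((\<Sum>j<N. (1 / 2) ^ j) * ?G)"
    using gaussian_mass_nonneg[where 'n='n] by (simp add: sum_ennreal sum_distrib_right)
  also have "\<dots> \<le> ennreal (2 * ?G)"
  proof (intro ennreal_leI mult_right_mono gaussian_mass_nonneg)
    have "(\<Sum>j<N. (1 / 2 :: real) ^ j) = 2 * (1 - (1 / 2) ^ N)"
      by (simp add: geometric_sum)
    then show "(\<Sum>j<N. (1 / 2 :: real) ^ j) \<le> 2" by simp
  qed
  finally show ?thesis .
qed

text \<open>For \<open>p = 1\<close> the general bound \<open>O(N\<^bsup>1/p\<^esup>)\<close> is not \<open>o(N)\<close>; there the terms of \<open>gaussian_sum\<close> have
  geometrically decreasing norms.\<close>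

lemma Lp_norm_gaussian_sum_le:
  assumes p: "1 \<le> p" "real (CARD('n) - 1) * p \<le> real CARD('n)" and d: "CARD('n) \<ge> 2"
  obtains K \<alpha> where "0 \<le> K" "\<alpha> < 1"
    "\<And>N. 1 \<le> N \<Longrightarrow> Lp_norm (ennreal p) (\<lambda>x :: real ^ 'n. ennreal (gaussian_sum N x)) \<le> ennreal (K * real N powr \<alpha>)"
proof (cases "p = 1")
  case True
  have "Lp_norm (ennreal p) (\<lambda>x :: real ^ 'n. ennreal (gaussian_sum N x)) \<le> ennreal ((2 * gaussian_mass TYPE('n)) powr (1 / p))" for N
    using nn_integral_gaussian_sum_le[where 'n='n] gaussian_mass_nonneg[where 'n='n]
    by (intro Lp_norm_le) (auto simp: gaussian_sum_nonneg True)
  \<comment> \<open>Exponent 0 expresses a bound uniform in \<open>N\<close>; since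
    \<open>0 powr 0 = 0\<close>, this needs \<open>N \<ge> 1\<close>.\<close>
  then show ?thesis
    by (intro that[of "(2 * gaussian_mass TYPE('n)) powr (1 / p)" 0]) auto
next
  case False
  let ?B = "3 * gaussian_mass TYPE('n)"
  have "p \<le> 2"
  proof -
    have "real (CARD('n) - 1) * p \<le> real (CARD('n) - 1) * 2" using p(2) d by (simp add: of_nat_diff)
    then show ?thesis by (rule mult_left_le_imp_le) (use d in simp)
  qed
  have "Lp_norm (ennreal p) (\<lambda>x :: real ^ 'n. ennreal (gaussian_sum N x)) \<le> ennreal (?B powr (1 / p) * real N powr (1 / p))" for N
  proof -
    have "Lp_norm (ennreal p) (\<lambda>x :: real ^ 'n. ennreal (gaussian_sum N x)) \<le> ennreal ((3 * real N * gaussian_mass TYPE('n)) powr (1 / p))"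
      using p \<open>p \<le> 2\<close> d gaussian_mass_nonneg[where 'n='n]
      by (intro Lp_norm_le nn_integral_gaussian_sum_powr_le) (auto simp: gaussian_sum_nonneg)
    also have "(3 * real N * gaussian_mass TYPE('n)) powr (1 / p) = ?B powr (1 / p) * real N powr (1 / p)"
      using gaussian_mass_nonneg[where 'n='n] by (subst powr_mult[symmetric]) (auto simp: mult_ac)
    finally show ?thesis .
  qed
  then show ?thesis
    using False p by (intro that[of "?B powr (1 / p)" "1 / p"]) auto
qed

lemma Lp_norm_gaussian_finite:
  assumes "1 \<le> q"
  shows "Lp_norm q (\<lambda>x :: real ^ 'n. ennreal (exp (- (x \<bullet> x)))) < \<infinity>"
proof (cases "q = \<infinity>")
  case True
  have "esssup lborel (\<lambda>x :: real ^ 'n. ennreal (exp (- (x \<bullet> x)))) \<le> 1"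
    by (intro esssup_I) auto
  then show ?thesis using True by (simp add: Lp_norm_def order_le_less_trans)
next
  case False
  then obtain s where s: "q = ennreal s" "0 \<le> s" by (cases q) auto
  with assms have "1 \<le> s" by (simp flip: ennreal_1)
  have "(\<integral>\<^sup>+ (x :: real ^ 'n). ennreal (exp (- (x \<bullet> x)) powr s) \<partial>lborel)
      = (\<integral>\<^sup>+ (x :: real ^ 'n). ennreal (exp (- s * (x \<bullet> x))) \<partial>lborel)"
    by (simp add: exp_powr_real mult.commute)
  also have "\<dots> \<le> ennreal (1 / 1 ^ CARD('n) * gaussian_mass TYPE('n))"
    using \<open>1 \<le> s\<close> by (intro nn_integral_gaussian_le_mass) auto
  finally have "Lp_norm q (\<lambda>x :: real ^ 'n. ennreal (exp (- (x \<bullet> x))))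
      \<le> ennreal ((1 / 1 ^ CARD('n) * gaussian_mass TYPE('n)) powr (1 / s))"
    unfolding s(1) using \<open>1 \<le> s\<close> gaussian_mass_nonneg[where 'n='n] by (intro Lp_norm_le) auto
  then show ?thesis by (rule order_le_less_trans) simp
qed


subsection \<open>Lower bound for the averages\<close>

text \<open>\<pi> and \<rho> stand for the two projections in either order, so that one proof serves
  both exponents. In the constant, 17 = 1 + 16: a dyadic Gaussian is at least exp(-1) on its cap,
  and the fixed Gaussian is at least exp(-16) on the manifold. The denominator comes from the cap
  bound at radius 2^(-j-1).\<close>

lemma triangle_average_lower_bound:
  fixes x :: "real ^ 'n" and \<pi> \<rho> :: "(real ^ 'n) \<times> (real ^ 'n) \<Rightarrow> real ^ 'n"
  assumes d: "CARD('n) \<ge> 2" and x: "1 \<le> norm x" "norm x \<le> 2"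
    and cont: "continuous_on UNIV \<pi>" "continuous_on UNIV \<rho>"
    and cap: "\<And>s e. 0 < s \<Longrightarrow> s \<le> 1 \<Longrightarrow> norm e = 1 \<Longrightarrow>
      s ^ (CARD('n) - 1) / 5 ^ CARD('n) \<le> measure triangle_measure (\<pi> -` cball e s)"
    and unit: "\<And>z. z \<in> triangle_manifold \<Longrightarrow> norm (\<rho> z) = 1"
  shows "exp (- 17) / (2 ^ (CARD('n) - 1) * 5 ^ CARD('n)) * real N \<le>
    (LINT z|triangle_measure. gaussian_sum N (x - norm x *\<^sub>R \<pi> z) *
      exp (- ((x - norm x *\<^sub>R \<rho> z) \<bullet> (x - norm x *\<^sub>R \<rho> z))))"
    (is "_ \<le> (LINT z|_. ?F z * ?g z)")
proof -
  let ?\<mu> = "triangle_measure :: ((real ^ 'n) \<times> (real ^ 'n)) measure"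
  interpret prob_space ?\<mu> by (rule prob_space_triangle_measure[OF d])
  define e where "e = x /\<^sub>R norm x"
  have "norm x \<noteq> 0" using x by linarith
  then have e: "norm e = 1" "norm x *\<^sub>R e = x" by (auto simp: e_def)
  \<comment> \<open>As \<open>norm x \<le> 2\<close>, a point within \<open>s j\<close> of
    \<open>e\<close> is dilated to within \<open>2^-j\<close> of \<open>x\<close>, the width of the
    Gaussian of index \<open>j\<close>.\<close>
  define s :: "nat \<Rightarrow> real" where "s = (\<lambda>j. 1 / (2 * 2 ^ j))"
  have s: "0 < s j" "s j \<le> 1" for j
  proof -
    have "(1::real) \<le> 2 ^ j" by simp
    then have "(1::real) \<le> 2 * 2 ^ j" by linarith
    then show "s j \<le> 1" by (simp add: s_def)
  qed (simp add: s_def)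
  let ?C = "\<lambda>j. \<pi> -` cball e (s j)"
  have C_sets: "?C j \<in> sets ?\<mu>" for j
    using cont(1) by (auto intro: borel_closed closed_vimage)
  \<comment> \<open>A step function below the integrand, whose integral is a sum of cap
    measures.\<close>
  define h where "h = (\<lambda>z. \<Sum>j<N. exp (- 17 :: real) * 2 ^ (j * (CARD('n) - 1)) * indicator (?C j) z)"
  have cont_F: "continuous_on UNIV (\<lambda>z. ?F z * ?g z)"
    by (intro continuous_intros cont)
  have bound_F: "norm (?F z * ?g z) \<le> (\<Sum>j<N. 2 ^ (j * (CARD('n) - 1))) * 1" for z
  proof -
    have "?F z \<le> (\<Sum>j<N. 2 ^ (j * (CARD('n) - 1)))"
      unfolding gaussian_sum_def by (intro sum_mono) (simp add: mult_le_cancel_left1)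
    then show ?thesis
      unfolding norm_mult by (intro mult_mono) (auto simp: gaussian_sum_nonneg sum_nonneg)
  qed
  have "integral\<^sup>L ?\<mu> h \<le> (LINT z|?\<mu>. ?F z * ?g z)"
  proof (rule integral_mono_AE)
    show "integrable ?\<mu> h"
      unfolding h_def using C_sets
      by (intro Bochner_Integration.integrable_sum integrable_mult_right integrable_real_indicator)
        (auto simp: less_top[symmetric])
    show "integrable ?\<mu> (\<lambda>z. ?F z * ?g z)"
      using bound_F cont_F by (intro integrable_const_bound[where B="(\<Sum>j<N. 2 ^ (j * (CARD('n) - 1))) * 1"] AE_I2)
        (auto intro!: borel_measurable_continuous_onI simp: measurable_cong_sets[OF sets_triangle_measure refl])
    \<comment> \<open>The lower bound for the fixed Gaussian uses
      \<open>norm (\<rho> z) = 1\<close>, known only on the manifold, which carries the whole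
      measure.\<close>
    have "AE z in ?\<mu>. z \<in> triangle_manifold"
      unfolding triangle_measure_def by (rule AE_uniform_measureI) (auto intro: borel_closed closed_triangle_manifold)
    then show "AE z in ?\<mu>. h z \<le> ?F z * ?g z"
    proof eventually_elim
      case (elim z)
      have "norm (x - norm x *\<^sub>R \<rho> z) \<le> norm x + norm x * 1"
        using norm_triangle_ineq4[of x "norm x *\<^sub>R \<rho> z"] unit[OF elim] by simp
      also have "\<dots> \<le> 4" using x by simp
      finally have "norm (x - norm x *\<^sub>R \<rho> z) ^ 2 \<le> 4 ^ 2" by (intro power_mono) auto
      then have g: "exp (- 16) \<le> ?g z" by (simp add: dot_square_norm)
      have pointwise: "exp (- 1) * 2 ^ (j * (CARD('n) - 1)) * indicator (?C j) z
          \<le> 2 ^ (j * (CARD('n) - 1)) * exp (- (4 ^ j) * ((x - norm x *\<^sub>R \<pi> z) \<bullet> (x - norm x *\<^sub>R \<pi> z)))" for j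
      proof (cases "z \<in> ?C j")
        case True
        have "norm (x - norm x *\<^sub>R \<pi> z) = norm (norm x *\<^sub>R (e - \<pi> z))"
          using e(2) by (simp add: scaleR_diff_right)
        also have "\<dots> = norm x * dist e (\<pi> z)" by (simp add: dist_norm)
        also have "\<dots> \<le> 2 * s j" using True x by (intro mult_mono) auto
        finally have "2 ^ j * norm (x - norm x *\<^sub>R \<pi> z) \<le> 1" by (simp add: s_def field_simps)
        then have "(2 ^ j * norm (x - norm x *\<^sub>R \<pi> z)) ^ 2 \<le> 1 ^ 2" by (intro power_mono) auto
        moreover have "((2::real) ^ j) ^ 2 = 4 ^ j" by (simp add: power2_eq_square power_mult_distrib[symmetric])
        ultimately have "4 ^ j * ((x - norm x *\<^sub>R \<pi> z) \<bullet> (x - norm x *\<^sub>R \<pi> z)) \<le> 1"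
          by (simp add: power_mult_distrib dot_square_norm)
        then show ?thesis using True by simp
      qed simp
      have e17: "exp (- 17 :: real) = exp (- 1) * exp (- 16)" by (simp add: exp_add[symmetric])
      have "h z = (\<Sum>j<N. exp (- 1) * 2 ^ (j * (CARD('n) - 1)) * indicator (?C j) z) * exp (- 16)"
        unfolding h_def e17 sum_distrib_right by (intro sum.cong refl) (simp only: mult_ac)
      also have "\<dots> \<le> ?F z * ?g z"
        unfolding gaussian_sum_def by (intro mult_mono sum_mono pointwise g) (auto intro: sum_nonneg)
      finally show ?case .
    qed
  qed
  moreover have "integral\<^sup>L ?\<mu> h = (\<Sum>j<N. exp (- 17) * 2 ^ (j * (CARD('n) - 1)) * measure ?\<mu> (?C j))"
    unfolding h_def using C_sets
    by (subst Bochner_Integration.integral_sum) (auto intro!: integrable_mult_right integrable_real_indicator simp: less_top[symmetric])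
  moreover have "exp (- 17) / (2 ^ (CARD('n) - 1) * 5 ^ CARD('n)) * real N
      \<le> (\<Sum>j<N. exp (- 17) * 2 ^ (j * (CARD('n) - 1)) * measure ?\<mu> (?C j))"
  proof -
    have "exp (- 17) / (2 ^ (CARD('n) - 1) * 5 ^ CARD('n)) \<le> exp (- 17) * 2 ^ (j * (CARD('n) - 1)) * measure ?\<mu> (?C j)" for j
    proof -
      have "exp (- 17) / (2 ^ (CARD('n) - 1) * 5 ^ CARD('n))
          = exp (- 17) * 2 ^ (j * (CARD('n) - 1)) * (s j ^ (CARD('n) - 1) / 5 ^ CARD('n))"
        by (simp add: s_def power_divide power_mult_distrib power_mult[symmetric])
      also have "\<dots> \<le> exp (- 17) * 2 ^ (j * (CARD('n) - 1)) * measure ?\<mu> (?C j)"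
        by (intro mult_left_mono cap s e) auto
      finally show ?thesis .
    qed
    then have "(\<Sum>j<N. exp (- 17) / (2 ^ (CARD('n) - 1) * 5 ^ CARD('n)))
        \<le> (\<Sum>j<N. exp (- 17) * 2 ^ (j * (CARD('n) - 1)) * measure ?\<mu> (?C j))"
      by (intro sum_mono)
    then show ?thesis by (simp add: mult.commute)
  qed
  ultimately show ?thesis by linarith
qed

lemma triangle_maximal_lower_bound:
  fixes x :: "real ^ 'n" and N :: nat
  assumes d: "CARD('n) \<ge> 2" and x: "1 \<le> norm x" "norm x \<le> 2"
  defines "F \<equiv> \<lambda>x :: real ^ 'n. complex_of_real (gaussian_sum N x)"
    and "g \<equiv> \<lambda>x :: real ^ 'n. complex_of_real (exp (- (x \<bullet> x)))"
    and "c \<equiv> exp (- 17) / (2 ^ (CARD('n) - 1) * 5 ^ CARD('n))"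
  shows "ennreal (c * real N) \<le> triangle_maximal F g x" "ennreal (c * real N) \<le> triangle_maximal g F x"
proof -
  let ?t = "norm x"
  have upper: "ennreal (norm (LINT (u, v)|triangle_measure. f (x - ?t *\<^sub>R u) * h (x - ?t *\<^sub>R v)))
      \<le> triangle_maximal f h x" for f h
    unfolding triangle_maximal_def using x by (intro SUP_upper) auto
  have unit: "norm u = 1 \<and> norm v = 1" if "(u, v) \<in> triangle_manifold" for u v :: "real ^ 'n"
    using that by (simp add: triangle_manifold_def)
  have "c * real N \<le> (LINT z|triangle_measure. gaussian_sum N (x - ?t *\<^sub>R fst z) *
      exp (- ((x - ?t *\<^sub>R snd z) \<bullet> (x - ?t *\<^sub>R snd z))))"
    unfolding c_def
  proof (rule triangle_average_lower_bound[OF d x])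
    fix s :: real and e :: "real ^ 'n" assume "0 < s" "s \<le> 1" "norm e = 1"
    then show "s ^ (CARD('n) - 1) / 5 ^ CARD('n) \<le> measure triangle_measure (fst -` cball e s)"
      using triangle_measure_cap_fst[of e s] d by (simp add: vimage_fst)
  qed (auto intro!: continuous_intros dest: unit)
  also have "\<dots> \<le> norm (complex_of_real \<dots>)" by simp
  also have "complex_of_real (LINT z|triangle_measure. gaussian_sum N (x - ?t *\<^sub>R fst z) *
      exp (- ((x - ?t *\<^sub>R snd z) \<bullet> (x - ?t *\<^sub>R snd z)))) =
      (LINT (u, v)|triangle_measure. F (x - ?t *\<^sub>R u) * g (x - ?t *\<^sub>R v))"
    by (simp add: F_def g_def case_prod_beta' integral_complex_of_real[symmetric] del: integral_complex_of_real)
  finally show "ennreal (c * real N) \<le> triangle_maximal F g x"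
    by (intro order_trans[OF ennreal_leI upper])
  have "c * real N \<le> (LINT z|triangle_measure. gaussian_sum N (x - ?t *\<^sub>R snd z) *
      exp (- ((x - ?t *\<^sub>R fst z) \<bullet> (x - ?t *\<^sub>R fst z))))"
    unfolding c_def
  proof (rule triangle_average_lower_bound[OF d x])
    fix s :: real and e :: "real ^ 'n" assume "0 < s" "s \<le> 1" "norm e = 1"
    then show "s ^ (CARD('n) - 1) / 5 ^ CARD('n) \<le> measure triangle_measure (snd -` cball e s)"
      using triangle_measure_cap_snd[of e s] d by (simp add: vimage_snd)
  qed (auto intro!: continuous_intros dest: unit)
  also have "\<dots> \<le> norm (complex_of_real \<dots>)" by simp
  also have "complex_of_real (LINT z|triangle_measure. gaussian_sum N (x - ?t *\<^sub>R snd z) *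
      exp (- ((x - ?t *\<^sub>R fst z) \<bullet> (x - ?t *\<^sub>R fst z)))) =
      (LINT (u, v)|triangle_measure. g (x - ?t *\<^sub>R u) * F (x - ?t *\<^sub>R v))"
    by (simp add: F_def g_def case_prod_beta' mult.commute integral_complex_of_real[symmetric] del: integral_complex_of_real)
  finally show "ennreal (c * real N) \<le> triangle_maximal g F x"
    by (intro order_trans[OF ennreal_leI upper])
qed

section \<open>From the pointwise lower bound to the contradiction\<close>

lemma annulus_emeasure_pos:
  obtains A :: "(real ^ 'n) set" and v where "A \<in> sets borel" "\<And>x. x \<in> A \<Longrightarrow> 1 \<le> norm x \<and> norm x \<le> 2"
    "emeasure lborel A = ennreal v" "0 < v"
proof -
  \<comment> \<open>A ball of radius 1/2 about a point of norm 3/2 lies in the annulus and has a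
    known volume.\<close>
  obtain y :: "real ^ 'n" where y: "norm y = 3 / 2"
    using vector_choose_size[of "3/2"] by auto
  have "1 \<le> norm x \<and> norm x \<le> 2" if "x \<in> ball y (1/2)" for x
    using that norm_triangle_ineq3[of y x] y by (auto simp: dist_norm)
  then show ?thesis
    using that[of "ball y (1/2)" "unit_ball_vol (real CARD('n)) * (1/2) ^ CARD('n)"]
    by (simp add: emeasure_ball)
qed

text \<open>Only monotonicity of the nonnegative integral is used, which holds for arbitrary
  functions, so measurability of the maximal function never comes up.\<close>

lemma Lp_norm_ge_on_set:
  assumes A: "A \<in> sets borel" "emeasure lborel A = ennreal v" "0 < v" and r: "0 < r" and "0 \<le> b"
    and T: "\<And>x. x \<in> A \<Longrightarrow> ennreal b \<le> T x"
  shows "ennreal (b * v powr (1 / r)) \<le> Lp_norm (ennreal r) T"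
proof -
  have "ennreal (b powr r * v) = (\<integral>\<^sup>+ x. ennreal (b powr r) * indicator A x \<partial>lborel)"
    using A by (simp add: nn_integral_cmult_indicator ennreal_mult)
  also have "\<dots> \<le> (\<integral>\<^sup>+ x. ennreal_powr (T x) r \<partial>lborel)"
  proof (rule nn_integral_mono)
    fix x
    show "ennreal (b powr r) * indicator A x \<le> ennreal_powr (T x) r"
      using ennreal_powr_mono[OF T, of x r] r \<open>0 \<le> b\<close> by (auto simp: indicator_def ennreal_powr_ennreal)
  qed
  finally have "ennreal_powr (ennreal (b powr r * v)) (1 / r) \<le> Lp_norm (ennreal r) T"
    using r by (simp add: Lp_norm_ennreal ennreal_powr_mono)
  moreover have "(b powr r * v) powr (1 / r) = b * v powr (1 / r)"
    using r A(3) \<open>0 \<le> b\<close> by (simp add: powr_mult powr_powr)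
  ultimately show ?thesis using A(3) by (simp add: ennreal_powr_ennreal)
qed

text \<open>The bound would give \<open>N powr (1 - \<alpha>) \<le> b/a\<close> for all positive
  \<open>N\<close>, although the left side is unbounded.\<close>

lemma sublinear_growth_contradiction:
  fixes a b \<alpha> :: real
  assumes "0 < a" "\<alpha> < 1" and le: "\<And>N::nat. 1 \<le> N \<Longrightarrow> a * real N \<le> b * real N powr \<alpha>"
  shows False
proof -
  define y where "y = \<bar>b\<bar> / a + 1"
  have y: "0 < y" using assms(1) by (simp add: y_def add_nonneg_pos)
  obtain N where N: "y powr (1 / (1 - \<alpha>)) < real N" using reals_Archimedean2 by blast
  have N0: "0 < real N" using N by (rule le_less_trans[rotated]) simp
  have "y = (y powr (1 / (1 - \<alpha>))) powr (1 - \<alpha>)" using y assms(2) by (simp add: powr_powr)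
  also have "\<dots> < real N powr (1 - \<alpha>)" using N assms(2) by (intro powr_less_mono2) auto
  also have "\<dots> = real N / real N powr \<alpha>" using N0 by (simp add: powr_diff)
  also have "\<dots> \<le> b / a"
    using le[of N] N0 assms(1) by (simp add: field_simps)
  also have "\<dots> \<le> \<bar>b\<bar> / a" using assms(1) by (intro divide_right_mono) auto
  finally show False by (simp add: y_def)
qed

text \<open>Stated for an abstract family \<open>T\<close> with \<open>p\<close> the exponent of the
  singular factor, so that it covers either position of that factor.\<close>

lemma gaussian_sum_refutes_bound:
  fixes T :: "nat \<Rightarrow> real ^ 'n \<Rightarrow> ennreal"
  assumes d: "CARD('n) \<ge> 2" and p: "1 \<le> p" "p \<le> ennreal (real CARD('n) / (real CARD('n) - 1))"
    and q: "1 \<le> q" and r: "inverse r = inverse p + inverse q" and c: "0 < c"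
    and T: "\<And>N x. 1 \<le> norm x \<Longrightarrow> norm x \<le> 2 \<Longrightarrow> ennreal (c * real N) \<le> T N x"
    and bound: "\<And>N. Lp_norm r (T N) \<le> ennreal C * Lp_norm p (\<lambda>x :: real ^ 'n. ennreal (gaussian_sum N x)) *
      Lp_norm q (\<lambda>x :: real ^ 'n. ennreal (exp (- (x \<bullet> x))))"
  shows False
proof -
  obtain p' where p': "p = ennreal p'" "0 \<le> p'" using p(2) by (cases p) (auto simp: top_unique)
  have "1 \<le> p'" using p(1) p' by (simp flip: ennreal_1)
  have "p' \<le> real CARD('n) / (real CARD('n) - 1)" using p(2) p' d by (simp add: ennreal_le_iff)
  then have p'_le: "real (CARD('n) - 1) * p' \<le> real CARD('n)" using d by (simp add: field_simps of_nat_diff)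
  obtain K \<alpha> where K: "0 \<le> K" "\<alpha> < 1"
    "\<And>N. 1 \<le> N \<Longrightarrow> Lp_norm (ennreal p') (\<lambda>x :: real ^ 'n. ennreal (gaussian_sum N x)) \<le> ennreal (K * real N powr \<alpha>)"
    using Lp_norm_gaussian_sum_le[OF \<open>1 \<le> p'\<close> p'_le d] by metis
  \<comment> \<open>Finite \<open>p\<close> excludes infinite \<open>r\<close>, and
    \<open>p, q \<ge> 1\<close> exclude \<open>r = 0\<close>, so the norm on the left is given by
    its integral formula with a positive real exponent.\<close>
  have "r \<noteq> \<infinity>"
  proof
    assume "r = \<infinity>"
    then have "inverse p = 0" using r by simp
    then show False using p' by simp
  qed
  have "r \<noteq> 0"
  proof
    assume "r = 0"
    then have "inverse p + inverse q = top" using r by simp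
    then have "inverse p = top \<or> inverse q = top" by (simp only: ennreal_add_eq_top)
    then show False using p(1) q by auto
  qed
  define r' where "r' = enn2real r"
  have "r < top" using \<open>r \<noteq> \<infinity>\<close> by (simp add: less_top)
  then have r'1: "r = ennreal r'" unfolding r'_def by (rule ennreal_enn2real[symmetric])
  have r'2: "0 < r'"
    unfolding r'_def enn2real_positive_iff using \<open>r < top\<close> \<open>r \<noteq> 0\<close> by (simp add: zero_less_iff_neq_zero)
  note r' = r'1 r'2
  define Q where "Q = enn2real (Lp_norm q (\<lambda>x :: real ^ 'n. ennreal (exp (- (x \<bullet> x)))))"
  have Q: "Lp_norm q (\<lambda>x :: real ^ 'n. ennreal (exp (- (x \<bullet> x)))) = ennreal Q" "0 \<le> Q"
    unfolding Q_def using Lp_norm_gaussian_finite[OF q, where 'n='n]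
    by (auto intro: ennreal_enn2real[symmetric])
  obtain A :: "(real ^ 'n) set" and v where A: "A \<in> sets borel" "\<And>x. x \<in> A \<Longrightarrow> 1 \<le> norm x \<and> norm x \<le> 2"
    "emeasure lborel A = ennreal v" "0 < v"
    using annulus_emeasure_pos by metis
  \<comment> \<open>The constant may be negative, in which case \<open>ennreal\<close> turns it into
    0.\<close>
  define C' where "C' = max 0 C"
  have C': "ennreal C = ennreal C'" "0 \<le> C'" by (auto simp: C'_def max_def ennreal_neg)
  have "(c * v powr (1 / r')) * real N \<le> (C' * K * Q) * real N powr \<alpha>" if "1 \<le> N" for N
  proof -
    have "ennreal (c * real N * v powr (1 / r')) \<le> Lp_norm r (T N)"
      unfolding r'(1) using A c r'(2) T by (intro Lp_norm_ge_on_set) auto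
    also have "\<dots> \<le> ennreal C' * Lp_norm p (\<lambda>x :: real ^ 'n. ennreal (gaussian_sum N x)) * ennreal Q"
      using bound[of N] by (simp only: C' Q)
    also have "\<dots> \<le> ennreal C' * ennreal (K * real N powr \<alpha>) * ennreal Q"
      unfolding p'(1) by (intro mult_right_mono mult_left_mono K that) auto
    also have "\<dots> = ennreal (C' * (K * real N powr \<alpha>) * Q)"
      using C' K Q by (simp add: ennreal_mult)
    finally have "c * real N * v powr (1 / r') \<le> C' * (K * real N powr \<alpha>) * Q"
      using C' K Q by (subst (asm) ennreal_le_iff) auto
    then show ?thesis by (simp add: mult_ac)
  qed
  then show False
    using c A(4) K(2) by (intro sublinear_growth_contradiction[of "c * v powr (1 / r')" \<alpha> "C' * K * Q"]) auto
qed

theorem mainTheorem4: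
  fixes p q r :: ennreal
  assumes "CARD('n::finite) \<ge> 3"
    and "1 \<le> p" and "1 \<le> q"
    and "inverse r = inverse p + inverse q"
    and "triangle_maximal_bounded TYPE('n) p q r"
  shows "p > ennreal (real CARD('n) / (real CARD('n) - 1)) \<and>
         q > ennreal (real CARD('n) / (real CARD('n) - 1))"
proof -
  have d: "CARD('n) \<ge> 2" using assms(1) by simp
  obtain C :: real where C: "\<And>f g :: real ^ 'n \<Rightarrow> complex. schwartz f \<Longrightarrow> schwartz g \<Longrightarrow>
      Lp_norm r (triangle_maximal f g) \<le>
        ennreal C * Lp_norm p (\<lambda>x. ennreal (norm (f x))) * Lp_norm q (\<lambda>x. ennreal (norm (g x)))"
    using assms(5) unfolding triangle_maximal_bounded_def by blast
  define F where "F = (\<lambda>N (x :: real ^ 'n). complex_of_real (gaussian_sum N x))"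
  define g where "g = (\<lambda>x :: real ^ 'n. complex_of_real (exp (- (x \<bullet> x))))"
  define c where "c = exp (- 17) / (2 ^ (CARD('n) - 1) * 5 ^ CARD('n) :: real)"
  have c: "0 < c" by (simp add: c_def)
  have sch: "schwartz (F N)" "schwartz g" for N
    unfolding F_def g_def by (rule schwartz_gaussian_sum schwartz_gaussian)+
  have nF: "norm (F N x) = gaussian_sum N x" and ng: "norm (g x) = exp (- (x \<bullet> x))" for N x
    by (simp_all add: F_def g_def gaussian_sum_nonneg)
  have "\<not> p \<le> ennreal (real CARD('n) / (real CARD('n) - 1))"
  proof
    assume p: "p \<le> ennreal (real CARD('n) / (real CARD('n) - 1))"
    show False
    proof (rule gaussian_sum_refutes_bound[OF d assms(2) p assms(3,4) c])
      show "ennreal (c * real N) \<le> triangle_maximal (F N) g x" if "1 \<le> norm x" "norm x \<le> 2" for N x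
        using triangle_maximal_lower_bound(1)[OF d that] by (simp add: F_def g_def c_def)
      show "Lp_norm r (triangle_maximal (F N) g) \<le> ennreal C * Lp_norm p (\<lambda>x :: real ^ 'n. ennreal (gaussian_sum N x)) *
          Lp_norm q (\<lambda>x :: real ^ 'n. ennreal (exp (- (x \<bullet> x))))" for N
        using C[OF sch(1)[of N] sch(2)] by (simp only: nF ng)
    qed
  qed
  moreover have "\<not> q \<le> ennreal (real CARD('n) / (real CARD('n) - 1))"
  proof
    assume q: "q \<le> ennreal (real CARD('n) / (real CARD('n) - 1))"
    \<comment> \<open>The same refutation with the exponents exchanged: the singular factor is now
      the second argument.\<close>
    have r: "inverse r = inverse q + inverse p" using assms(4) by (simp add: add.commute)
    show False
    proof (rule gaussian_sum_refutes_bound[OF d assms(3) q assms(2) r c])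
      show "ennreal (c * real N) \<le> triangle_maximal g (F N) x" if "1 \<le> norm x" "norm x \<le> 2" for N x
        using triangle_maximal_lower_bound(2)[OF d that] by (simp add: F_def g_def c_def)
      show "Lp_norm r (triangle_maximal g (F N)) \<le> ennreal C * Lp_norm q (\<lambda>x :: real ^ 'n. ennreal (gaussian_sum N x)) *
          Lp_norm p (\<lambda>x :: real ^ 'n. ennreal (exp (- (x \<bullet> x))))" for N
        using C[OF sch(2) sch(1)[of N]] by (simp only: nF ng mult.assoc mult.commute mult.left_commute)
    qed
  qed
  ultimately show ?thesis by (simp add: not_le)
qed

end
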